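(* Let $d\ge1$. The set $SPS$ of $2d\times 2d$ real singular symplectic matrices equals the set of all matrices of the form $$Q\,M_{10}M_{9}\cdots M_{2}M_{1}\,Q^{-1},$$ where $Q\in\mathbb{R}^{2d\times 2d}$ is symplectic, and for $i=1,\dots,5$, $$M_{2i-1}=\begin{bmatrix}I&S_{2i-1}\\0&I\end{bmatrix},\qquad M_{2i}=\begin{bmatrix}I&0\\\begin{bmatrix}0&0\\0&S_{2i}\end{bmatrix}&I\end{bmatrix},$$ with $S_{2i-1}\in\mathbb{R}^{d\times d}$ symmetric and $S_{2i}\in\mathbb{R}^{(d-1)\times(d-1)}$ symmetric. Moreover, $Q$ can be expressed as a product of $9$ unit triangular symplectic matrices.
   Context: Let $I=I_d$ and $J=\begin{bmatrix} 0 & I_{d} \\ -I_{d} & 0 \end{bmatrix}$. A matrix $H\in\mathbb{R}^{2d\times 2d}$ is symplectic if $H^{T}JH=J$. A symplectic matrix $H$ is called singular if $\det(H-I_{2d})=0$ (i.e. $1$ is an eigenvalue of $H$). In $\begin{bmatrix}0&0\\0&S_{2i}\end{bmatrix}\in\mathbb{R}^{d\times d}$ the top-left block is $1\times 1$. The unit triangular symplectic matrices are those of the form $\begin{bmatrix} I & S \\ 0 & I\end{bmatrix}$ or $\begin{bmatrix} I & 0 \\ S & I\end{bmatrix}$ with $S\in\mathbb{R}^{d\times d}$ symmetric. *)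

theory Defs
  imports Complex_Main "Jordan_Normal_Form.Matrix" "Jordan_Normal_Form.Determinant"
begin

definition J_mat :: "nat \<Rightarrow> real mat" where
  "J_mat d = four_block_mat (0\<^sub>m d d) (1\<^sub>m d) (- 1\<^sub>m d) (0\<^sub>m d d)"

definition symplectic :: "nat \<Rightarrow> real mat set" where
  "symplectic d = {H \<in> carrier_mat (2 * d) (2 * d). transpose_mat H * J_mat d * H = J_mat d}"

definition SPS :: "nat \<Rightarrow> real mat set" where
  "SPS d = {H \<in> symplectic d. det (H - 1\<^sub>m (2 * d)) = 0}"

definition symmetric_mats :: "nat \<Rightarrow> real mat set" where
  "symmetric_mats n = {S \<in> carrier_mat n n. transpose_mat S = S}"

definition upper_unit :: "nat \<Rightarrow> real mat \<Rightarrow> real mat" where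
  "upper_unit d S = four_block_mat (1\<^sub>m d) S (0\<^sub>m d d) (1\<^sub>m d)"

definition lower_unit :: "nat \<Rightarrow> real mat \<Rightarrow> real mat" where
  "lower_unit d S = four_block_mat (1\<^sub>m d) (0\<^sub>m d d) S (1\<^sub>m d)"

definition unit_triangular_symplectic :: "nat \<Rightarrow> real mat set" where
  "unit_triangular_symplectic d =
     upper_unit d ` symmetric_mats d \<union> lower_unit d ` symmetric_mats d"

(* For d = 1 the argument T is the 0 x 0 matrix and the result is the 1 x 1 zero matrix. *)
definition pad_zero :: "nat \<Rightarrow> real mat \<Rightarrow> real mat" where
  "pad_zero d T = four_block_mat (0\<^sub>m 1 1) (0\<^sub>m 1 (d - 1)) (0\<^sub>m (d - 1) 1) T"

end

theory Submission
  imports Defs "Jordan_Normal_Form.Jordan_Normal_Form_Existence"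
begin

text \<open>
  Let a symplectic matrix have first block column \<open>(A, C)\<close>. Since \<open>A + \<i> C\<close> is nonsingular,
  \<open>A + t C\<close> is nonsingular for some real \<open>t\<close>, and after an upper unit triangular factor a
  block LDU factorization leaves the block diagonal matrix \<open>diag (A, A\<^sup>-\<^sup>T)\<close>. By a theorem of Frobenius
  \<open>A = X Y\<close> with \<open>X\<close>, \<open>Y\<close> symmetric and invertible, and then \<open>diag (A, A\<^sup>-\<^sup>T)\<close> is the product of
  \<open>(0, X; -X\<^sup>-\<^sup>1, 0)\<close> and \<open>(0, -Y\<^sup>-\<^sup>1; Y, 0)\<close>, each of which is a product of three unit triangular
  matrices. Altogether this needs seven factors.

  A singular symplectic matrix fixes some \<open>v \<noteq> 0\<close>; as the symplectic group acts transitively on nonzero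
  vectors, it is conjugate to one fixing \<open>e\<^sub>1\<close>. For such a matrix the lower factor of the
  LDU factorization kills \<open>e\<^sub>1\<close>, and \<open>A + t C = (1, a; 0, A\<^sub>2)\<close>. The block \<open>A\<^sub>2\<close> is treated by
  Frobenius' theorem in dimension \<open>d - 1\<close>, and the remaining shear is a product of four factors, the
  lower ones padded by zero; merging neighbours gives the ten factors.
\<close>

section \<open>Real matrices as products of two symmetric matrices\<close>

text \<open>The reversal matrix works: an entry of a Jordan block depends only on the difference of
  its indices, so reversing both rows and columns transposes the block.\<close>

lemma jordan_block_flip:
  fixes a :: "'a :: comm_ring_1"
  obtains F where "F \<in> carrier_mat n n" "transpose_mat F = F" "F * F = 1\<^sub>m n"
    "F * jordan_block n a = transpose_mat (jordan_block n a) * F"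
proof
  let ?F = "mat n n (\<lambda>(i, j). if Suc (i + j) = n then 1 else 0 :: 'a)"
  have entry: "row ?F i \<bullet> v = v $ (n - 1 - i)" if "i < n" "v \<in> carrier_vec n" for i v
  proof -
    have "row ?F i \<bullet> v = (\<Sum>k\<in>{0..<n}. if k = n - 1 - i then v $ k else 0)"
      unfolding scalar_prod_def using that by (intro sum.cong) auto
    then show ?thesis using that by simp
  qed
  show F: "?F \<in> carrier_mat n n" by simp
  show sym: "transpose_mat ?F = ?F" by (intro eq_matI) auto
  show "?F * ?F = 1\<^sub>m n"
    by (intro eq_matI) (auto simp: entry simp del: row_mat)
  show "?F * jordan_block n a = transpose_mat (jordan_block n a) * ?F"
  proof (rule eq_matI; (simp only: index_mult_mat index_transpose_mat dim_row_mat dim_col_mat jordan_block_index)?)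
    fix i j assume ij: "i < n" "j < n"
    \<comment> \<open>Both sides reduce to single entries of the Jordan block, at
      \<open>(n - 1 - i, j)\<close> and at \<open>(n - 1 - j, i)\<close>; these positions lie on the
      same diagonal.\<close>
    have "col ?F j = row ?F j" by (subst sym[symmetric]) (use ij in simp)
    then have "row (transpose_mat (jordan_block n a)) i \<bullet> col ?F j = row ?F j \<bullet> col (jordan_block n a) i"
      using ij comm_scalar_prod[of "row ?F j" n "col (jordan_block n a) i"] by (simp del: row_mat)
    then show "row ?F i \<bullet> col (jordan_block n a) j = row (transpose_mat (jordan_block n a)) i \<bullet> col ?F j"
      using ij entry[of i "col (jordan_block n a) j"] entry[of j "col (jordan_block n a) i"]
      by (simp del: row_mat) auto
  qed
qed

text \<open>By induction on the list of blocks: the flips of the single blocks are assembled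
  block-diagonally, in the layout of \<open>jordan_matrix\<close>.\<close>

lemma jordan_matrix_flip:
  fixes n_as :: "(nat \<times> 'a :: comm_ring_1) list"
  defines "m \<equiv> sum_list (map fst n_as)"
  obtains F where "F \<in> carrier_mat m m" "transpose_mat F = F" "F * F = 1\<^sub>m m"
    "F * jordan_matrix n_as = transpose_mat (jordan_matrix n_as) * F"
proof -
  have "\<exists>F \<in> carrier_mat m m. transpose_mat F = F \<and> F * F = 1\<^sub>m m \<and>
      F * jordan_matrix n_as = transpose_mat (jordan_matrix n_as) * F"
    unfolding m_def
  proof (induction n_as)
    case Nil
    show ?case by (intro bexI[of _ "1\<^sub>m 0"]) (auto simp: jordan_matrix_def)
  next
    case (Cons na n_as)
    obtain n a where na: "na = (n, a)" by force
    let ?k = "sum_list (map fst n_as)"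
    let ?J = "jordan_block n a" and ?K = "jordan_matrix n_as"
    from Cons obtain G where G: "G \<in> carrier_mat ?k ?k" "transpose_mat G = G" "G * G = 1\<^sub>m ?k"
      "G * ?K = transpose_mat ?K * G" by auto
    obtain F where F: "F \<in> carrier_mat n n" "transpose_mat F = F" "F * F = 1\<^sub>m n"
      "F * ?J = transpose_mat ?J * F" using jordan_block_flip .
    have K: "?K \<in> carrier_mat ?k ?k" by auto
    let ?H = "four_block_mat F (0\<^sub>m n ?k) (0\<^sub>m ?k n) G"
    have J: "jordan_matrix (na # n_as) = four_block_mat ?J (0\<^sub>m n ?k) (0\<^sub>m ?k n) ?K"
      by (simp add: na jordan_matrix_Cons)
    have "?H * jordan_matrix (na # n_as) = transpose_mat (jordan_matrix (na # n_as)) * ?H"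
      unfolding J using F G K
      by (simp add: mult_four_block_mat[of _ n n _ ?k _ ?k _ _ n _ ?k]
          transpose_four_block_mat[of _ n n _ ?k _ ?k])
    moreover have "transpose_mat ?H = ?H" "?H * ?H = 1\<^sub>m (n + ?k)" using F G
      by (simp_all add: mult_four_block_mat[of _ n n _ ?k _ ?k _ _ n _ ?k]
          transpose_four_block_mat[of _ n n _ ?k _ ?k])
    moreover have "?H \<in> carrier_mat (n + ?k) (n + ?k)" using F G by simp
    ultimately show ?case using na by auto
  qed
  then show ?thesis using that by blast
qed

text \<open>Over the complex numbers A = P J Q with J a Jordan matrix and Q the inverse of P. If F
  flips J, then F J is symmetric, and so is S A = Q^T (F J) Q for S = Q^T F Q.\<close>

lemma complex_symmetrizer:
  fixes A :: "complex mat"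
  assumes A: "A \<in> carrier_mat n n"
  obtains S where "S \<in> carrier_mat n n" "transpose_mat S = S" "det S \<noteq> 0" "S * A = transpose_mat A * S"
proof -
  obtain as where "char_poly A = (\<Prod>a\<leftarrow>as. [:- a, 1:])" using char_poly_factorized[OF A] by blast
  then obtain n_as where "jordan_nf A n_as" using jordan_nf_exists[OF A] by blast
  then have "similar_mat A (jordan_matrix n_as)" by (simp add: jordan_nf_def)
  then obtain P Q where "similar_mat_wit A (jordan_matrix n_as) P Q" by (auto simp: similar_mat_def)
  note w = similar_mat_witD2[OF A this]
  let ?J = "jordan_matrix n_as"
  have m: "sum_list (map fst n_as) = n" using carrier_matD(1)[OF w(5)] by simp
  obtain F where F: "F \<in> carrier_mat n n" "transpose_mat F = F" "F * F = 1\<^sub>m n"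
    "F * ?J = transpose_mat ?J * F" using jordan_matrix_flip[of n_as] m by auto
  let ?S = "transpose_mat Q * F * Q"
  note assoc = assoc_mult_mat[of _ n n _ n _ n]
  have "?S * A = transpose_mat Q * (F * ((Q * P) * (?J * Q)))"
    unfolding w(3) using w(4-7) F(1) by (simp add: assoc left_mult_one_mat[of _ n n])
  also have "\<dots> = transpose_mat Q * (transpose_mat ?J * F * Q)"
    unfolding w(2) F(4)[symmetric] using w(4-7) F(1) by (simp add: assoc left_mult_one_mat[of _ n n])
  also have "\<dots> = transpose_mat Q * (transpose_mat ?J * (transpose_mat (Q * P) * (F * Q)))"
    unfolding w(2) using w(4-7) F(1) by (simp add: assoc left_mult_one_mat[of _ n n])
  also have "\<dots> = transpose_mat A * ?S"
    unfolding w(3) using w(4-7) F(1) by (simp add: assoc transpose_mult[of _ n n _ n])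
  finally have 1: "?S * A = transpose_mat A * ?S" .
  have "det P * det Q = 1" "det F * det F = 1"
    using det_mult[OF w(6,7)] det_mult[OF F(1) F(1)] w(1) F(3) by simp_all
  then have "det Q \<noteq> 0" "det F \<noteq> 0" by auto
  then have 2: "det ?S \<noteq> 0" using w F(1) by (simp add: det_mult[of _ n] det_transpose)
  have 3: "transpose_mat ?S = ?S" using w F by (simp add: assoc transpose_mult[of _ n n _ n])
  show ?thesis using that[of ?S] 1 2 3 w F(1) by simp
qed

text \<open>det (X + z Y) is a polynomial in z. Being nonzero at the imaginary unit, it has only
  finitely many roots, and some real \<open>t\<close> is none of them.\<close>

lemma real_shift_nonsingular:
  fixes X Y :: "real mat"
  assumes X: "X \<in> carrier_mat n n" and Y: "Y \<in> carrier_mat n n"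
    and det: "det (map_mat complex_of_real X + \<i> \<cdot>\<^sub>m map_mat complex_of_real Y) \<noteq> 0"
  obtains t :: real where "det (X + t \<cdot>\<^sub>m Y) \<noteq> 0"
proof -
  let ?c = complex_of_real
  \<comment> \<open>\<open>M\<close> is X + z Y as a matrix of polynomials in z; evaluation at a
    point is a ring homomorphism and so commutes with \<open>det\<close>.\<close>
  define M where "M = mat n n (\<lambda>(i, j). [:?c (X $$ (i, j)), ?c (Y $$ (i, j)):])"
  have eval: "poly (det M) z = det (map_mat ?c X + z \<cdot>\<^sub>m map_mat ?c Y)" for z
  proof -
    have ev: "comm_ring_hom (\<lambda>p :: complex poly. poly p z)" by unfold_locales auto
    have "map_mat (\<lambda>p. poly p z) M = map_mat ?c X + z \<cdot>\<^sub>m map_mat ?c Y"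
      unfolding M_def using X Y by (intro eq_matI) auto
    then show ?thesis using comm_ring_hom.hom_det[OF ev, of M] by simp
  qed
  from det have "det M \<noteq> 0" using eval[of \<i>] by auto
  then have "finite {z. poly (det M) z = 0}" by (rule poly_roots_finite)
  then have "finite (?c -` {z. poly (det M) z = 0})" by (intro finite_vimageI) (auto simp: inj_on_def)
  then obtain t where t: "poly (det M) (?c t) \<noteq> 0"
    using ex_new_if_finite[OF infinite_UNIV_char_0] by (metis (mono_tags, lifting) mem_Collect_eq vimageI2)
  have "map_mat ?c X + ?c t \<cdot>\<^sub>m map_mat ?c Y = map_mat ?c (X + t \<cdot>\<^sub>m Y)"
    using X Y by (intro eq_matI) auto
  with t show ?thesis using that[of t] eval[of "?c t"] of_real_hom.hom_det[of "X + t \<cdot>\<^sub>m Y"] by auto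
qed

lemma det_nonzero_inverse:
  fixes A :: "'a :: field mat"
  assumes A: "A \<in> carrier_mat n n" and "det A \<noteq> 0"
  obtains B where "B \<in> carrier_mat n n" "A * B = 1\<^sub>m n" "B * A = 1\<^sub>m n"
  using det_non_zero_imp_unit[OF assms, of undefined] unfolding Units_def ring_mat_def by auto

text \<open>The real and imaginary parts of a complex symmetrizer are themselves symmetrizers of the real matrix \<open>A\<close>,
  so is every real combination of them, and some combination is nonsingular.\<close>

lemma real_symmetrizer:
  fixes A :: "real mat"
  assumes A: "A \<in> carrier_mat n n"
  obtains S where "S \<in> carrier_mat n n" "transpose_mat S = S" "det S \<noteq> 0" "S * A = transpose_mat A * S"
proof -
  let ?c = complex_of_real
  obtain Z where Z: "Z \<in> carrier_mat n n" "transpose_mat Z = Z" "det Z \<noteq> 0"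
    "Z * map_mat ?c A = transpose_mat (map_mat ?c A) * Z"
    using complex_symmetrizer[of "map_mat ?c A" n] A by auto
  define X where "X = map_mat Re Z"
  define Y where "Y = map_mat Im Z"
  have carrier: "X \<in> carrier_mat n n" "Y \<in> carrier_mat n n" using Z by (auto simp: X_def Y_def)
  have "map_mat ?c X + \<i> \<cdot>\<^sub>m map_mat ?c Y = Z"
    using Z by (intro eq_matI) (auto simp: X_def Y_def complex_eq_iff)
  then obtain t where t: "det (X + t \<cdot>\<^sub>m Y) \<noteq> 0"
    using real_shift_nonsingular[OF carrier] Z(3) by metis
  \<comment> \<open>Written out entrywise, the relation passes to real and imaginary parts term by
    term, because \<open>A\<close> has real entries.\<close>
  have entry: "(\<Sum>k<n. Z $$ (i, k) * ?c (A $$ (k, j))) = (\<Sum>k<n. ?c (A $$ (k, i)) * Z $$ (k, j))"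
    if "i < n" "j < n" for i j
    using arg_cong[OF Z(4), of "\<lambda>M. M $$ (i, j)"] that A Z(1)
    by (simp add: scalar_prod_def atLeast0LessThan)
  have sym: "Z $$ (i, j) = Z $$ (j, i)" if "i < n" "j < n" for i j
    using arg_cong[OF Z(2), of "\<lambda>M. M $$ (i, j)"] that Z(1) by simp
  have comm: "X * A = transpose_mat A * X" "Y * A = transpose_mat A * Y"
    using arg_cong[OF entry, of _ _ Re] arg_cong[OF entry, of _ _ Im] A Z(1)
    by (auto intro!: eq_matI simp: X_def Y_def scalar_prod_def atLeast0LessThan)
  have "(X + t \<cdot>\<^sub>m Y) * A = transpose_mat A * (X + t \<cdot>\<^sub>m Y)"
    using comm A carrier
    by (simp add: add_mult_distrib_mat[of _ n n _ _ n] mult_add_distrib_mat[of _ n n _ n]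
        mult_smult_distrib[of _ n n _ n] mult_smult_assoc_mat[of _ n n _ n])
  moreover have "transpose_mat (X + t \<cdot>\<^sub>m Y) = X + t \<cdot>\<^sub>m Y"
    using Z(1) sym by (intro eq_matI) (auto simp: X_def Y_def)
  ultimately show ?thesis using that[of "X + t \<cdot>\<^sub>m Y"] t carrier by auto
qed

lemma symmetric_inverse:
  assumes S: "S \<in> symmetric_mats n" and R: "R \<in> carrier_mat n n" and SR: "S * R = 1\<^sub>m n"
  shows "R \<in> symmetric_mats n"
proof -
  have S': "S \<in> carrier_mat n n" "transpose_mat S = S" using S by (auto simp: symmetric_mats_def)
  have "R * S = 1\<^sub>m n" using mat_mult_left_right_inverse[OF S'(1) R SR] .
  then have 1: "transpose_mat R * S = 1\<^sub>m n" using arg_cong[OF SR, of transpose_mat] S' R 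
    by (simp add: transpose_mult[of _ n n _ n])
  have "transpose_mat R = transpose_mat R * (S * R)" using R SR by simp
  also have "\<dots> = R" using S'(1) R 1 by (subst assoc_mult_mat[of _ n n _ n _ n, symmetric]) auto
  finally show ?thesis using R by (simp add: symmetric_mats_def)
qed

text \<open>For a symmetrizer \<open>S\<close> take X = S^-1 and Y = S A; the latter is symmetric
  since its transpose is A^T S. The inverses are delivered as well, because the triangular factors
  are built from them.\<close>

lemma frobenius_symmetric_product:
  assumes A: "A \<in> carrier_mat n n" and "det A \<noteq> 0"
  obtains X X' Y Y' where "X \<in> symmetric_mats n" "X' \<in> symmetric_mats n"
    "Y \<in> symmetric_mats n" "Y' \<in> symmetric_mats n"
    "X * X' = 1\<^sub>m n" "X' * X = 1\<^sub>m n" "Y * Y' = 1\<^sub>m n" "Y' * Y = 1\<^sub>m n" "A = X * Y"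
proof -
  obtain S where S: "S \<in> carrier_mat n n" "transpose_mat S = S" "det S \<noteq> 0" "S * A = transpose_mat A * S"
    using real_symmetrizer[OF A] .
  obtain X where X: "X \<in> carrier_mat n n" "S * X = 1\<^sub>m n" "X * S = 1\<^sub>m n"
    using det_nonzero_inverse[OF S(1,3)] .
  have "det (S * A) \<noteq> 0" using assms S(1,3) by (simp add: det_mult[of _ n])
  then obtain Y' where Y': "Y' \<in> carrier_mat n n" "S * A * Y' = 1\<^sub>m n" "Y' * (S * A) = 1\<^sub>m n"
    using det_nonzero_inverse[of "S * A" n] S(1) A by auto
  have sym: "S \<in> symmetric_mats n" "S * A \<in> symmetric_mats n"
    using S A by (auto simp: symmetric_mats_def transpose_mult[of _ n n _ n])
  have "A = X * (S * A)" using X S(1) A by (subst assoc_mult_mat[of _ n n _ n _ n, symmetric]) auto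
  then show ?thesis
    using that[of X S "S * A" Y'] sym X Y' symmetric_inverse[OF sym(1) X(1,2)] symmetric_inverse[OF sym(2) Y'(1,2)]
    by blast
qed

section \<open>Symmetric matrices and their action on vectors\<close>

lemma real_scalar_prod_self_eq_0:
  fixes v :: "real vec"
  assumes "v \<in> carrier_vec n" "v \<bullet> v = 0"
  shows "v = 0\<^sub>v n"
proof -
  have "(\<Sum>i\<in>{0..<n}. v $ i * v $ i) = 0" using assms by (simp add: scalar_prod_def)
  then have "\<forall>i\<in>{0..<n}. v $ i * v $ i = 0" by (subst (asm) sum_nonneg_eq_0_iff) auto
  then show ?thesis using assms(1) by (intro eq_vecI) auto
qed

lemma real_scalar_prod_self_nonneg: "v \<bullet> v \<ge> (0 :: real)"
  unfolding scalar_prod_def by (intro sum_nonneg) auto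

lemma smult_one_symmetric: "t \<cdot>\<^sub>m 1\<^sub>m d \<in> symmetric_mats d"
  by (auto simp: symmetric_mats_def intro!: eq_matI)

lemma symmetric_mats_carrier: "S \<in> symmetric_mats n \<Longrightarrow> S \<in> carrier_mat n n"
  by (simp add: symmetric_mats_def)

lemma symmetric_mats_add: "S \<in> symmetric_mats n \<Longrightarrow> T \<in> symmetric_mats n \<Longrightarrow> S + T \<in> symmetric_mats n"
  by (auto simp: symmetric_mats_def transpose_add[of _ n n])

lemma symmetric_mats_uminus: "S \<in> symmetric_mats n \<Longrightarrow> - S \<in> symmetric_mats n"
  by (auto simp: symmetric_mats_def transpose_uminus)

lemma symmetric_mats_zero: "0\<^sub>m n n \<in> symmetric_mats n"
  by (auto simp: symmetric_mats_def)

lemma symmetric_mats_one: "1\<^sub>m n \<in> symmetric_mats n"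
  by (auto simp: symmetric_mats_def)

text \<open>This lets a unit triangular factor change one half of a vector by any prescribed amount,
  as long as the other half is nonzero.\<close>

lemma symmetric_transport:
  fixes x y :: "real vec"
  assumes x: "x \<in> carrier_vec n" "x \<noteq> 0\<^sub>v n" and y: "y \<in> carrier_vec n"
  obtains S where "S \<in> symmetric_mats n" "S *\<^sub>v x = y"
proof
  define q where "q = (\<Sum>j\<in>{0..<n}. x $ j * x $ j)"
  define p where "p = (\<Sum>j\<in>{0..<n}. y $ j * x $ j)"
  have "x \<bullet> x = q" using x by (simp add: scalar_prod_def q_def)
  then have q: "q \<noteq> 0" using real_scalar_prod_self_eq_0[OF x(1)] x(2) by auto
  \<comment> \<open>The symmetrized rank-one term sends \<open>x\<close> to y + (p/q) x, and the
    multiple of x x^T that is subtracted removes the excess.\<close>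
  let ?S = "mat n n (\<lambda>(i, j). (x $ i * y $ j + y $ i * x $ j) / q - p * x $ i * x $ j / q\<^sup>2)"
  show "?S \<in> symmetric_mats n" by (auto simp: symmetric_mats_def algebra_simps intro!: eq_matI)
  show "?S *\<^sub>v x = y"
  proof (rule eq_vecI)
    fix i assume "i < dim_vec y"
    then have i: "i < n" using y by simp
    then have "(?S *\<^sub>v x) $ i = (\<Sum>j\<in>{0..<n}. ((x $ i * y $ j + y $ i * x $ j) / q - p * x $ i * x $ j / q\<^sup>2) * x $ j)"
      using x by (simp add: scalar_prod_def)
    also have "\<dots> = (\<Sum>j\<in>{0..<n}. x $ i / q * (y $ j * x $ j) + y $ i / q * (x $ j * x $ j) - p * x $ i / q\<^sup>2 * (x $ j * x $ j))"
      by (intro sum.cong refl) (simp add: algebra_simps add_divide_distrib)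
    also have "\<dots> = x $ i / q * p + y $ i / q * q - p * x $ i / q\<^sup>2 * q"
      by (simp only: sum.distrib sum_subtractf sum_distrib_left[symmetric] p_def q_def)
    also have "\<dots> = y $ i" using q by (simp add: field_simps power2_eq_square)
    finally show "(?S *\<^sub>v x) $ i = y $ i" .
  qed (use y in simp)
qed

section \<open>Block calculus for symplectic matrices\<close>

context
  fixes d :: nat
begin

text \<open>The dimensions are instantiated by \<open>d\<close> because most of them occur only in
  premises, where rewriting cannot guess them.\<close>

lemmas square_assoc = assoc_mult_mat[of _ d d _ d _ d]
lemmas square_transpose = transpose_mult[of _ d d _ d] transpose_add[of _ d d] transpose_uminus
lemmas square_add = assoc_add_mat[of _ d d] comm_add_mat[of _ d d]
lemmas square_distrib = add_mult_distrib_mat[of _ d d _ _ d] mult_add_distrib_mat[of _ d d _ d]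
lemmas square_units = left_mult_one_mat[of _ d d] right_mult_one_mat[of _ d d]
  left_mult_zero_mat[of _ d d d] right_mult_zero_mat[of _ d d d]
  left_add_zero_mat[of _ d d] right_add_zero_mat[of _ d d]

lemma square_add_left_commute:
  "A \<in> carrier_mat d d \<Longrightarrow> B \<in> carrier_mat d d \<Longrightarrow> C \<in> carrier_mat d d \<Longrightarrow>
    A + (B + C) = B + (A + (C :: 'a :: comm_monoid_add mat))"
  by (intro eq_matI) (auto simp: ac_simps)

lemmas square_simps = square_assoc square_transpose square_add square_add_left_commute square_distrib square_units

lemma square_uminus_mult:
  fixes A B :: "'a :: ring mat"
  assumes "A \<in> carrier_mat d d" "B \<in> carrier_mat d d"
  shows "- A * B = - (A * B)" "A * - B = - (A * B)"
  using assms by simp_all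

lemma uminus_zero_mat: "- (0\<^sub>m d d :: 'a :: group_add mat) = 0\<^sub>m d d"
  by (intro eq_matI) auto

lemma square_add_uminus:
  fixes A B :: "'a :: ab_group_add mat"
  assumes "A \<in> carrier_mat d d" "B \<in> carrier_mat d d"
  shows "A + - A = 0\<^sub>m d d" "A + (- A + B) = B" "- A + A = 0\<^sub>m d d" "- A + (A + B) = B"
  using assms by (auto intro!: eq_matI)

lemmas square_mult = mult_four_block_mat[of _ d d _ d _ d _ _ d _ d]

lemma square_blocks_inject:
  assumes "A \<in> carrier_mat d d" "B \<in> carrier_mat d d" "C \<in> carrier_mat d d" "D \<in> carrier_mat d d"
    and "A' \<in> carrier_mat d d" "B' \<in> carrier_mat d d" "C' \<in> carrier_mat d d" "D' \<in> carrier_mat d d"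
  shows "four_block_mat A B C D = four_block_mat A' B' C' D' \<longleftrightarrow> A = A' \<and> B = B' \<and> C = C' \<and> D = D'"
proof
  assume eq: "four_block_mat A B C D = four_block_mat A' B' C' D'"
  have e: "four_block_mat A B C D $$ (i, j) = four_block_mat A' B' C' D' $$ (i, j)" for i j
    by (simp only: eq)
  have "A $$ (i, j) = A' $$ (i, j)" "B $$ (i, j) = B' $$ (i, j)"
    "C $$ (i, j) = C' $$ (i, j)" "D $$ (i, j) = D' $$ (i, j)" if "i < d" "j < d" for i j
    using e[of i j] e[of i "d + j"] e[of "d + i" j] e[of "d + i" "d + j"] that assms by auto
  then show "A = A' \<and> B = B' \<and> C = C' \<and> D = D'"
    using assms by (intro conjI eq_matI) auto
qed simp

lemma square_blocks_exist:
  assumes "H \<in> carrier_mat (2 * d) (2 * d)"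
  obtains A B C D where "A \<in> carrier_mat d d" "B \<in> carrier_mat d d" "C \<in> carrier_mat d d" "D \<in> carrier_mat d d"
    "H = four_block_mat A B C D"
proof -
  obtain A B C D where s: "split_block H d d = (A, B, C, D)" by (metis prod_cases4)
  show ?thesis using split_block[OF s, of d d] assms that by auto
qed

section \<open>The symplectic condition in blocks and the symplectic group\<close>

text \<open>Multiplying out H^T J H = J gives four block equations. The lower left one is minus the
  transpose of the upper right one, so three remain.\<close>

lemma symplectic_four_block_iff:
  assumes carrier: "A \<in> carrier_mat d d" "B \<in> carrier_mat d d" "C \<in> carrier_mat d d" "D \<in> carrier_mat d d"
  shows "four_block_mat A B C D \<in> symplectic d \<longleftrightarrow>
    transpose_mat A * C = transpose_mat C * A \<and> transpose_mat B * D = transpose_mat D * B \<and>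
    transpose_mat A * D = 1\<^sub>m d + transpose_mat C * B"
proof -
  let ?T = transpose_mat
  have T: "?T A \<in> carrier_mat d d" "?T B \<in> carrier_mat d d" "?T C \<in> carrier_mat d d" "?T D \<in> carrier_mat d d"
    using carrier by auto
  have sub: "M + - N = 0\<^sub>m d d \<longleftrightarrow> M = N" if "M \<in> carrier_mat d d" "N \<in> carrier_mat d d" for M N :: "real mat"
  proof
    assume e: "M + - N = 0\<^sub>m d d"
    have "M $$ (i, j) = N $$ (i, j)" if "i < d" "j < d" for i j
      using arg_cong[OF e, of "\<lambda>M. M $$ (i, j)"] that \<open>M \<in> _\<close> \<open>N \<in> _\<close> by simp
    then show "M = N" using that by (intro eq_matI) auto
  qed (use that in \<open>intro eq_matI; auto\<close>)
  have shift: "M + - N = K \<longleftrightarrow> M = K + N"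
    if "M \<in> carrier_mat d d" "N \<in> carrier_mat d d" "K \<in> carrier_mat d d" for M N K :: "real mat"
  proof
    assume "M + - N = K"
    then show "M = K + N" using that by (intro eq_matI) auto
  next
    assume "M = K + N"
    then show "M + - N = K" using that by (intro eq_matI) auto
  qed
  have mono: "four_block_mat A B C D \<in> carrier_mat (2 * d) (2 * d)"
    using four_block_carrier_mat[OF carrier(1,4)] by (simp add: mult_2)
  have "?T (four_block_mat A B C D) * J_mat d * four_block_mat A B C D =
    four_block_mat (?T A * C + - (?T C * A)) (?T A * D + - (?T C * B))
      (- (?T D * A) + ?T B * C) (?T B * D + - (?T D * B))"
    unfolding J_mat_def transpose_four_block_mat[OF carrier] using carrier T
    by (simp add: square_mult square_units square_uminus_mult square_add)
  also have "\<dots> = J_mat d \<longleftrightarrow> ?T A * C = ?T C * A \<and> ?T B * D = ?T D * B \<and>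
      ?T A * D = 1\<^sub>m d + ?T C * B \<and> - (?T D * A) + ?T B * C = - 1\<^sub>m d"
    unfolding J_mat_def using carrier T
    by (subst square_blocks_inject) (auto simp: sub shift)
  also have "\<dots> \<longleftrightarrow> ?T A * C = ?T C * A \<and> ?T B * D = ?T D * B \<and> ?T A * D = 1\<^sub>m d + ?T C * B"
  proof -
    have "- (?T D * A) + ?T B * C = - 1\<^sub>m d" if e: "?T A * D = 1\<^sub>m d + ?T C * B"
    proof -
      have "?T D * A = 1\<^sub>m d + ?T B * C"
        using arg_cong[OF e, of ?T] carrier T by (simp add: square_transpose)
      then show ?thesis using carrier T by (intro eq_matI) auto
    qed
    then show ?thesis by blast
  qed
  finally show ?thesis using mono by (simp add: symplectic_def)
qed

lemma upper_unit_carrier: "S \<in> carrier_mat d d \<Longrightarrow> upper_unit d S \<in> carrier_mat (2 * d) (2 * d)"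
  unfolding upper_unit_def by (simp add: mult_2)

lemma lower_unit_carrier: "S \<in> carrier_mat d d \<Longrightarrow> lower_unit d S \<in> carrier_mat (2 * d) (2 * d)"
  unfolding lower_unit_def by (simp add: mult_2)

lemma upper_unit_mult_block:
  assumes "S \<in> carrier_mat d d" "A \<in> carrier_mat d d" "B \<in> carrier_mat d d" "C \<in> carrier_mat d d" "D \<in> carrier_mat d d"
  shows "upper_unit d S * four_block_mat A B C D = four_block_mat (A + S * C) (B + S * D) C D"
  unfolding upper_unit_def using assms by (simp add: square_mult square_units)

lemma lower_unit_mult_block:
  assumes "S \<in> carrier_mat d d" "A \<in> carrier_mat d d" "B \<in> carrier_mat d d" "C \<in> carrier_mat d d" "D \<in> carrier_mat d d"
  shows "lower_unit d S * four_block_mat A B C D = four_block_mat A B (S * A + C) (S * B + D)"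
  unfolding lower_unit_def using assms by (simp add: square_mult square_units)

lemma upper_unit_add:
  assumes "S \<in> carrier_mat d d" "T \<in> carrier_mat d d"
  shows "upper_unit d (S + T) = upper_unit d S * upper_unit d T"
  unfolding upper_unit_def using assms by (simp add: square_mult square_units square_add)

lemma lower_unit_add:
  assumes "S \<in> carrier_mat d d" "T \<in> carrier_mat d d"
  shows "lower_unit d (S + T) = lower_unit d S * lower_unit d T"
  unfolding lower_unit_def using assms by (simp add: square_mult square_units square_add)

lemma upper_unit_symplectic: "S \<in> symmetric_mats d \<Longrightarrow> upper_unit d S \<in> symplectic d"
  unfolding upper_unit_def by (subst symplectic_four_block_iff) (auto simp: symmetric_mats_def square_units)

lemma lower_unit_symplectic: "S \<in> symmetric_mats d \<Longrightarrow> lower_unit d S \<in> symplectic d"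
  unfolding lower_unit_def by (subst symplectic_four_block_iff) (auto simp: symmetric_mats_def square_units)

lemma J_mat_carrier: "J_mat d \<in> carrier_mat (2 * d) (2 * d)"
  unfolding J_mat_def by (simp add: mult_2)

lemma J_mat_square: "J_mat d * J_mat d = - 1\<^sub>m (2 * d)"
proof -
  have "J_mat d * J_mat d = four_block_mat (- 1\<^sub>m d) (0\<^sub>m d d) (0\<^sub>m d d) (- 1\<^sub>m d)"
    unfolding J_mat_def by (simp add: square_mult square_units uminus_zero_mat)
  also have "\<dots> = - 1\<^sub>m (2 * d)" by (intro eq_matI) auto
  finally show ?thesis .
qed

lemma symplectic_carrier: "H \<in> symplectic d \<Longrightarrow> H \<in> carrier_mat (2 * d) (2 * d)"
  by (simp add: symplectic_def)

lemma double_closed: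
  "A \<in> carrier_mat (2 * d) (2 * d) \<Longrightarrow> B \<in> carrier_mat (2 * d) (2 * d) \<Longrightarrow> A * B \<in> carrier_mat (2 * d) (2 * d)"
  by (rule mult_carrier_mat)

lemmas double_assoc = double_closed assoc_mult_mat[of _ "2 * d" "2 * d" _ "2 * d" _ "2 * d"]
  assoc_mult_mat_vec[of _ "2 * d" "2 * d" _ "2 * d"]

lemma symplectic_mult:
  assumes "G \<in> symplectic d" "H \<in> symplectic d"
  shows "G * H \<in> symplectic d"
proof -
  have c: "G \<in> carrier_mat (2 * d) (2 * d)" "H \<in> carrier_mat (2 * d) (2 * d)"
    using assms by (auto simp: symplectic_def)
  have "transpose_mat (G * H) * J_mat d * (G * H) =
      transpose_mat H * (transpose_mat G * J_mat d * G) * H"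
    using c J_mat_carrier by (simp add: double_assoc transpose_mult[of _ "2 * d" "2 * d" _ "2 * d"])
  then show ?thesis using assms c by (auto simp: symplectic_def)
qed

text \<open>Since J^2 = -1, the condition H^T J H = J says that -J H^T J is a left inverse of
  \<open>H\<close>, and for square matrices it is then two-sided.\<close>

lemma symplectic_inverse:
  assumes "H \<in> symplectic d"
  obtains K where "K \<in> symplectic d" "H * K = 1\<^sub>m (2 * d)" "K * H = 1\<^sub>m (2 * d)"
proof
  have H: "H \<in> carrier_mat (2 * d) (2 * d)" "transpose_mat H * J_mat d * H = J_mat d"
    using assms by (auto simp: symplectic_def)
  let ?K = "- (J_mat d * transpose_mat H * J_mat d)"
  have K: "?K \<in> carrier_mat (2 * d) (2 * d)" using H J_mat_carrier by simp
  have "?K * H = - (J_mat d * (transpose_mat H * J_mat d * H))"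
    using H(1) J_mat_carrier by (simp add: double_assoc)
  then show KH: "?K * H = 1\<^sub>m (2 * d)" unfolding H(2) J_mat_square by simp
  show HK: "H * ?K = 1\<^sub>m (2 * d)" using mat_mult_left_right_inverse[OF K H(1) KH] .
  \<comment> \<open>Replacing the middle J by H^T J H turns the product into (H K)^T J (H K), which
    is J.\<close>
  have "transpose_mat ?K * J_mat d * ?K = transpose_mat ?K * (transpose_mat H * J_mat d * H) * ?K"
    unfolding H(2) ..
  also have "\<dots> = transpose_mat (H * ?K) * J_mat d * (H * ?K)"
    using H(1) K J_mat_carrier by (simp add: double_assoc transpose_mult[of _ "2 * d" "2 * d" _ "2 * d"] del: uminus_mult_right_mat uminus_mult_left_mat)
  also have "\<dots> = J_mat d" unfolding HK using J_mat_carrier by simp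
  finally show "?K \<in> symplectic d" using K by (simp add: symplectic_def)
qed

section \<open>Explicit factorizations of block diagonal symplectic matrices\<close>

text \<open>For \<open>E = 1\<close> this factors \<open>diag (A, A\<^sup>-\<^sup>T)\<close> for \<open>A = X Y\<close>. A general idempotent \<open>E\<close> makes
  the lemma applicable to padded matrices \<open>X\<close>, \<open>Y\<close>, where \<open>X'\<close>, \<open>Y'\<close> are only inverses on the
  range of \<open>E\<close>.\<close>

lemma symplectic_block_diagonal_factor:
  assumes X: "X \<in> carrier_mat d d" "X' \<in> carrier_mat d d" and Y: "Y \<in> carrier_mat d d" "Y' \<in> carrier_mat d d"
    and E: "E \<in> carrier_mat d d"
    and inv: "X * X' = E" "X' * X = E" "Y * Y' = E" "Y' * Y = E"
    and unit: "X * E = X" "X' * E = X'" "E * Y = Y" "E * Y' = Y'" "Y' * E = Y'"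
  shows "upper_unit d X * (lower_unit d (- X') * (upper_unit d (X + - Y') *
      (lower_unit d Y * upper_unit d (- Y')))) =
    four_block_mat (1\<^sub>m d + - E + X * Y) (0\<^sub>m d d) (0\<^sub>m d d) (1\<^sub>m d + - E + X' * Y')"
proof -
  note carrier = X Y E
  note simps = square_simps square_uminus_mult square_add_uminus uminus_zero_mat uminus_add_mat[of _ d d]
  have inv': "X * (X' * M) = E * M" "X' * (X * M) = E * M" if "M \<in> carrier_mat d d" for M
    using carrier that by (simp_all add: square_assoc[symmetric] inv del: assoc_mult_mat)
  let ?F = "1\<^sub>m d + - E"
  \<comment> \<open>For \<open>E = 1\<close> the factors are the triples upper X, lower -X', upper X
    and upper -Y', lower Y, upper -Y', each an antidiagonal block matrix; the two neighbours in the
    middle are merged into \<open>X + - Y'\<close>. The product is evaluated from the right.\<close>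
  have "lower_unit d Y * upper_unit d (- Y') = four_block_mat (1\<^sub>m d) (- Y') Y ?F"
    unfolding upper_unit_def using carrier by (subst lower_unit_mult_block) (auto simp: simps inv)
  also have "upper_unit d (X + - Y') * \<dots> = four_block_mat (?F + X * Y) (- Y') Y ?F"
    using carrier by (subst upper_unit_mult_block) (auto simp: simps inv unit)
  also have "lower_unit d (- X') * \<dots> = four_block_mat (?F + X * Y) (- Y') (0\<^sub>m d d) (?F + X' * Y')"
    using carrier by (subst lower_unit_mult_block) (auto simp: simps inv inv' unit)
  also have "upper_unit d X * \<dots> = four_block_mat (?F + X * Y) (0\<^sub>m d d) (0\<^sub>m d d) (?F + X' * Y')"
    using carrier by (subst upper_unit_mult_block) (auto simp: simps inv inv' unit)
  finally show ?thesis .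
qed

text \<open>Conjugating \<open>upper_unit d S\<close> by \<open>lower_unit d P\<close> leaves -P S P
  = 0 in the lower left block, and the last factor clears the upper right block. With a padded
  \<open>P\<close>, a shear is thus obtained from padded lower factors.\<close>

lemma symplectic_shear_factor:
  assumes P: "P \<in> carrier_mat d d" and S: "S \<in> carrier_mat d d" and PSP: "P * (S * P) = 0\<^sub>m d d"
  shows "lower_unit d P * (upper_unit d S * (lower_unit d (- P) * upper_unit d (- (S + S * (P * S))))) =
    four_block_mat (1\<^sub>m d + - (S * P)) (0\<^sub>m d d) (0\<^sub>m d d) (1\<^sub>m d + P * S)"
proof -
  note simps = square_simps square_uminus_mult square_add_uminus uminus_zero_mat uminus_add_mat[of _ d d]
  have PSP': "P * (S * (P * M)) = 0\<^sub>m d d" if M: "M \<in> carrier_mat d d" for M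
  proof -
    have "P * (S * (P * M)) = (P * (S * P)) * M" using P S M by (simp add: square_assoc)
    then show ?thesis using M by (simp add: PSP)
  qed
  let ?T = "S + S * (P * S)"
  have "lower_unit d (- P) * upper_unit d (- ?T) = four_block_mat (1\<^sub>m d) (- ?T) (- P) (1\<^sub>m d + P * S)"
    unfolding upper_unit_def[of d "- ?T"] using P S by (subst lower_unit_mult_block) (auto simp: simps PSP')
  also have "upper_unit d S * \<dots> = four_block_mat (1\<^sub>m d + - (S * P)) (0\<^sub>m d d) (- P) (1\<^sub>m d + P * S)"
    using P S by (subst upper_unit_mult_block) (auto simp: simps)
  also have "lower_unit d P * \<dots> = four_block_mat (1\<^sub>m d + - (S * P)) (0\<^sub>m d d) (0\<^sub>m d d) (1\<^sub>m d + P * S)"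
    using P S by (subst lower_unit_mult_block) (auto simp: simps PSP)
  finally show ?thesis .
qed

section \<open>Block LDU factorization after a real shift\<close>

text \<open>Gaussian elimination on blocks; the symplectic relations make both triangular factors
  symmetric and the Schur complement equal to A^-T. The latter enters as any \<open>D0\<close> with
  A^T D0 = 1, so that each application can supply its own expression for it.\<close>

lemma symplectic_LDU:
  assumes carrier: "A \<in> carrier_mat d d" "B \<in> carrier_mat d d" "C \<in> carrier_mat d d" "D \<in> carrier_mat d d"
    and sympl: "four_block_mat A B C D \<in> symplectic d"
    and R: "R \<in> carrier_mat d d" "A * R = 1\<^sub>m d" "R * A = 1\<^sub>m d"
    and D0: "D0 \<in> carrier_mat d d" "transpose_mat A * D0 = 1\<^sub>m d"
  shows "C * R \<in> symmetric_mats d" "R * B \<in> symmetric_mats d"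
    "four_block_mat A B C D =
      lower_unit d (C * R) * (four_block_mat A (0\<^sub>m d d) (0\<^sub>m d d) D0 * upper_unit d (R * B))"
proof -
  let ?T = transpose_mat
  have s: "?T A * C = ?T C * A" "?T B * D = ?T D * B" "?T A * D = 1\<^sub>m d + ?T C * B"
    using sympl carrier by (auto simp: symplectic_four_block_iff)
  have TR: "?T R * ?T A = 1\<^sub>m d" "?T A * ?T R = 1\<^sub>m d"
    using arg_cong[OF R(2), of ?T] arg_cong[OF R(3), of ?T] R(1) carrier by (simp_all add: square_transpose)
  have cancel: "?T R * (?T A * M) = M" "A * (R * M) = M" if "M \<in> carrier_mat d d" for M
  proof -
    have "?T R * (?T A * M) = (?T R * ?T A) * M" "A * (R * M) = (A * R) * M"
      using R(1) carrier that by (simp_all add: square_assoc)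
    then show "?T R * (?T A * M) = M" "A * (R * M) = M" using that by (simp_all add: TR R)
  qed
  have D0_eq: "D0 = ?T R" using cancel(1)[OF D0(1)] R(1) by (simp add: D0 square_units)
  have "C * R = ?T R * (?T A * C * R)" using cancel(1)[of "C * R"] carrier R(1) by (simp add: square_assoc)
  also have "\<dots> = ?T R * ?T C * (A * R)" unfolding s(1) using carrier R(1) by (simp add: square_assoc)
  also have "\<dots> = ?T (C * R)" using R carrier by (simp add: square_simps)
  finally have W: "?T (C * R) = C * R" ..
  then show "C * R \<in> symmetric_mats d" using carrier R(1) by (simp add: symmetric_mats_def)
  \<comment> \<open>The third block relation, solved for \<open>D\<close>, shows that the Schur
    complement of \<open>A\<close> is \<open>D0\<close>.\<close>
  have "D = ?T R * (1\<^sub>m d + ?T C * B)" using cancel(1)[OF carrier(4)] s(3) by simp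
  also have "\<dots> = D0 + ?T (C * R) * B" using carrier R(1) by (simp add: square_simps D0_eq)
  finally have D: "D = D0 + C * R * B" by (simp only: W)
  have "?T (C * R * B) = ?T B * (C * R)"
    using carrier R(1) by (subst transpose_mult[of _ d d _ d]) (auto simp only: W mult_carrier_mat)
  then have WB: "?T (C * (R * B)) * B = ?T B * (C * (R * B))"
    using carrier R(1) by (simp add: square_assoc)
  \<comment> \<open>Inserting this \<open>D\<close> into B^T D = D^T B, the symmetric term B^T (C R)
    B cancels; what is left says that B^T A^-T, the transpose of \<open>R * B\<close>, is
    symmetric.\<close>
  have "?T B * D0 + ?T B * (C * R * B) = ?T D0 * B + ?T B * (C * R * B)"
    using s(2) carrier R(1) D0(1) unfolding D 
    by (simp add: square_distrib square_assoc transpose_add[of _ d d] WB)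
  moreover have "(M + K = N + K) = (M = N)" if "M \<in> carrier_mat d d" "N \<in> carrier_mat d d" "K \<in> carrier_mat d d"
    for M N K :: "real mat"
  proof
    assume e: "M + K = N + K"
    have "M = (M + K) + - K" using that by (intro eq_matI) auto
    also have "\<dots> = N" unfolding e using that by (intro eq_matI) auto
    finally show "M = N" .
  qed simp
  ultimately have "?T B * D0 = ?T D0 * B" using carrier R(1) D0(1) by simp
  then show "R * B \<in> symmetric_mats d"
    using carrier R(1) by (simp add: symmetric_mats_def D0_eq square_transpose)
  show "four_block_mat A B C D =
      lower_unit d (C * R) * (four_block_mat A (0\<^sub>m d d) (0\<^sub>m d d) D0 * upper_unit d (R * B))"
    unfolding upper_unit_def using carrier R D0(1)
    by (simp add: square_mult square_units lower_unit_mult_block cancel)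
      (simp add: D square_add square_assoc)
qed

text \<open>If \<open>(A + \<i> C) (x + \<i> y) = 0\<close>, then \<open>A x = C y\<close> and \<open>A y = - C x\<close>; symmetry of \<open>A\<^sup>T C\<close>
  gives \<open>|C y|\<^sup>2 = - |C x|\<^sup>2\<close>, so \<open>x\<close> and \<open>y\<close> lie in the common kernel of \<open>A\<close> and \<open>C\<close>.\<close>

lemma symplectic_complex_shift:
  assumes carrier: "A \<in> carrier_mat d d" "B \<in> carrier_mat d d" "C \<in> carrier_mat d d" "D \<in> carrier_mat d d"
    and sympl: "four_block_mat A B C D \<in> symplectic d"
  shows "det (map_mat complex_of_real A + \<i> \<cdot>\<^sub>m map_mat complex_of_real C) \<noteq> 0"
proof
  let ?T = transpose_mat
  let ?M = "map_mat complex_of_real A + \<i> \<cdot>\<^sub>m map_mat complex_of_real C"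
  have s: "?T A * C = ?T C * A" "?T A * D = 1\<^sub>m d + ?T C * B"
    using sympl carrier by (auto simp: symplectic_four_block_iff)
  assume "det ?M = 0"
  moreover have "?M \<in> carrier_mat d d" using carrier by simp
  ultimately obtain v where v: "v \<in> carrier_vec d" "v \<noteq> 0\<^sub>v d" "?M *\<^sub>v v = 0\<^sub>v d"
    using det_0_iff_vec_prod_zero by blast
  define x where "x = map_vec Re v"
  define y where "y = map_vec Im v"
  have xy: "x \<in> carrier_vec d" "y \<in> carrier_vec d" using v by (auto simp: x_def y_def)
  have entry: "(\<Sum>j\<in>{0..<d}. (complex_of_real (A $$ (i, j)) + \<i> * complex_of_real (C $$ (i, j))) * v $ j) = 0"
    if "i < d" for i
    using arg_cong[OF v(3), of "\<lambda>w. w $ i"] that v(1) carrier by (simp add: scalar_prod_def)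
  have Ax: "A *\<^sub>v x = C *\<^sub>v y"
    using arg_cong[OF entry, of _ Re] carrier v(1)
    by (auto intro!: eq_vecI simp: x_def y_def scalar_prod_def sum_subtractf)
  have Ay: "A *\<^sub>v y = - (C *\<^sub>v x)"
    using arg_cong[OF entry, of _ Im] carrier v(1)
    by (auto intro!: eq_vecI simp: x_def y_def scalar_prod_def sum.distrib eq_neg_iff_add_eq_0)
  have "(C *\<^sub>v y) \<bullet> (C *\<^sub>v y) = (A *\<^sub>v x) \<bullet> (C *\<^sub>v y)" by (simp only: Ax)
  also have "\<dots> = x \<bullet> ((?T A * C) *\<^sub>v y)"
    using transpose_vec_mult_scalar[of "?T A" d d "C *\<^sub>v y" x] carrier xy by simp
  also have "\<dots> = (C *\<^sub>v x) \<bullet> (A *\<^sub>v y)"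
    unfolding s(1) using transpose_vec_mult_scalar[of "?T C" d d "A *\<^sub>v y" x] carrier xy by simp
  also have "\<dots> = - ((C *\<^sub>v x) \<bullet> (C *\<^sub>v x))" unfolding Ay by simp
  finally have "(C *\<^sub>v x) \<bullet> (C *\<^sub>v x) = 0" "(C *\<^sub>v y) \<bullet> (C *\<^sub>v y) = 0"
    using real_scalar_prod_self_nonneg[of "C *\<^sub>v x"] real_scalar_prod_self_nonneg[of "C *\<^sub>v y"] by linarith+
  then have C0: "C *\<^sub>v x = 0\<^sub>v d" "C *\<^sub>v y = 0\<^sub>v d"
    using carrier xy by (auto intro: real_scalar_prod_self_eq_0)
  then have A0: "A *\<^sub>v x = 0\<^sub>v d" "A *\<^sub>v y = 0\<^sub>v d" unfolding Ax Ay by simp_all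
  \<comment> \<open>This transposed relation, D^T A - B^T C = 1, shows that \<open>A\<close> and
    \<open>C\<close> have no nonzero common kernel vector.\<close>
  have "?T D * A = 1\<^sub>m d + ?T B * C"
    using arg_cong[OF s(2), of ?T] carrier by (simp add: square_transpose)
  then have id: "?T D *\<^sub>v (A *\<^sub>v w) = w + ?T B *\<^sub>v (C *\<^sub>v w)" if "w \<in> carrier_vec d" for w
  proof -
    have "?T D *\<^sub>v (A *\<^sub>v w) = (?T D * A) *\<^sub>v w"
      using carrier that by (simp add: assoc_mult_mat_vec[of _ d d _ d])
    also have "\<dots> = w + ?T B *\<^sub>v (C *\<^sub>v w)"
      unfolding \<open>?T D * A = _\<close> using carrier that
      by (simp add: add_mult_distrib_mat_vec[of _ d d] assoc_mult_mat_vec[of _ d d _ d])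
    finally show ?thesis .
  qed
  have zero: "?T M *\<^sub>v 0\<^sub>v d = 0\<^sub>v d" if "M \<in> carrier_mat d d" for M
    using that by (intro eq_vecI) auto
  have "x = 0\<^sub>v d" using id[OF xy(1)] xy(1) carrier by (simp add: A0 C0 zero)
  moreover have "y = 0\<^sub>v d" using id[OF xy(2)] xy(2) carrier by (simp add: A0 C0 zero)
  ultimately have "v = 0\<^sub>v d" using v(1)
    by (auto intro!: eq_vecI simp: x_def y_def complex_eq_iff vec_eq_iff)
  with v show False by simp
qed

text \<open>An upper factor with block \<open>t\<close> times the identity replaces \<open>A\<close>
  by A + t C, which is invertible for suitable \<open>t\<close>. The diagonal part is left
  unfactored, since a general matrix and one fixing the first unit vector require different
  factorizations of it.\<close>

lemma symplectic_ULDU: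
  assumes carrier: "A \<in> carrier_mat d d" "B \<in> carrier_mat d d" "C \<in> carrier_mat d d" "D \<in> carrier_mat d d"
    and sympl: "four_block_mat A B C D \<in> symplectic d"
  obtains t R where "R \<in> carrier_mat d d" "(A + t \<cdot>\<^sub>m C) * R = 1\<^sub>m d" "R * (A + t \<cdot>\<^sub>m C) = 1\<^sub>m d"
    "C * R \<in> symmetric_mats d" "R * (B + t \<cdot>\<^sub>m D) \<in> symmetric_mats d"
    "\<And>D0. D0 \<in> carrier_mat d d \<Longrightarrow> transpose_mat (A + t \<cdot>\<^sub>m C) * D0 = 1\<^sub>m d \<Longrightarrow>
      four_block_mat A B C D = upper_unit d ((- t) \<cdot>\<^sub>m 1\<^sub>m d) * (lower_unit d (C * R) *
        (four_block_mat (A + t \<cdot>\<^sub>m C) (0\<^sub>m d d) (0\<^sub>m d d) D0 * upper_unit d (R * (B + t \<cdot>\<^sub>m D))))"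
proof -
  obtain t where t: "det (A + t \<cdot>\<^sub>m C) \<noteq> 0"
    using real_shift_nonsingular[OF carrier(1,3) symplectic_complex_shift[OF carrier sympl]] .
  let ?A = "A + t \<cdot>\<^sub>m C" and ?B = "B + t \<cdot>\<^sub>m D"
  have AB: "?A \<in> carrier_mat d d" "?B \<in> carrier_mat d d" using carrier by auto
  obtain R where R: "R \<in> carrier_mat d d" "?A * R = 1\<^sub>m d" "R * ?A = 1\<^sub>m d"
    using det_nonzero_inverse[OF AB(1) t] .
  have shift: "upper_unit d (t \<cdot>\<^sub>m 1\<^sub>m d) * four_block_mat A B C D = four_block_mat ?A ?B C D"
    using carrier by (simp add: upper_unit_mult_block mult_smult_assoc_mat[of _ d d _ d])
  have "four_block_mat ?A ?B C D \<in> symplectic d"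
    unfolding shift[symmetric] using symplectic_mult[OF upper_unit_symplectic[OF smult_one_symmetric] sympl] .
  note LDU = symplectic_LDU[OF AB carrier(3,4) this R]
  \<comment> \<open>The symmetry claims of the LDU lemma do not mention \<open>D0\<close> but
    presuppose one; the transpose of \<open>R\<close> serves.\<close>
  have "?A * R = 1\<^sub>m d" "transpose_mat ?A * transpose_mat R = 1\<^sub>m d"
    using R AB(1) by (simp_all flip: transpose_mult[of _ d d _ d])
  then have D0: "transpose_mat R \<in> carrier_mat d d" "transpose_mat ?A * transpose_mat R = 1\<^sub>m d" using R by auto
  have unshift: "four_block_mat A B C D = upper_unit d ((- t) \<cdot>\<^sub>m 1\<^sub>m d) * four_block_mat ?A ?B C D"
  proof -
    have "(A + t \<cdot>\<^sub>m C) + (- t) \<cdot>\<^sub>m C = A" "(B + t \<cdot>\<^sub>m D) + (- t) \<cdot>\<^sub>m D = B"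
      using carrier by (auto intro!: eq_matI)
    then show ?thesis
      using carrier AB by (simp add: upper_unit_mult_block mult_smult_assoc_mat[of _ d d _ d])
  qed
  show ?thesis
    using that[OF R LDU(1,2)[OF D0]] LDU(3) unshift by metis
qed

section \<open>Counting and merging the triangular factors\<close>

lemma upper_unit_zero: "upper_unit d (0\<^sub>m d d) = 1\<^sub>m (2 * d)"
  unfolding upper_unit_def by (simp add: mult_2)

lemma lower_unit_zero: "lower_unit d (0\<^sub>m d d) = 1\<^sub>m (2 * d)"
  unfolding lower_unit_def by (simp add: mult_2)

text \<open>Two factors stand to the left of the diagonal part and one to its right. The diagonal
  part takes five, and its last upper factor merges with the one to its right.\<close>

lemma symplectic_seven_factors:
  assumes "H \<in> symplectic d"
  obtains S1 S2 S3 S4 S5 S6 S7 where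
    "{S1, S2, S3, S4, S5, S6, S7} \<subseteq> symmetric_mats d"
    "H = upper_unit d S7 * (lower_unit d S6 * (upper_unit d S5 * (lower_unit d S4 *
      (upper_unit d S3 * (lower_unit d S2 * upper_unit d S1)))))"
proof -
  obtain A B C D where carrier: "A \<in> carrier_mat d d" "B \<in> carrier_mat d d" "C \<in> carrier_mat d d" "D \<in> carrier_mat d d"
    and H: "H = four_block_mat A B C D"
    using square_blocks_exist[OF symplectic_carrier[OF assms]] .
  obtain t R where R: "R \<in> carrier_mat d d" "(A + t \<cdot>\<^sub>m C) * R = 1\<^sub>m d" "R * (A + t \<cdot>\<^sub>m C) = 1\<^sub>m d"
    and sym: "C * R \<in> symmetric_mats d" "R * (B + t \<cdot>\<^sub>m D) \<in> symmetric_mats d"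
    and eq: "\<And>D0. D0 \<in> carrier_mat d d \<Longrightarrow> transpose_mat (A + t \<cdot>\<^sub>m C) * D0 = 1\<^sub>m d \<Longrightarrow>
      H = upper_unit d ((- t) \<cdot>\<^sub>m 1\<^sub>m d) * (lower_unit d (C * R) *
        (four_block_mat (A + t \<cdot>\<^sub>m C) (0\<^sub>m d d) (0\<^sub>m d d) D0 * upper_unit d (R * (B + t \<cdot>\<^sub>m D))))"
    using symplectic_ULDU[OF carrier] assms unfolding H by blast
  have A': "A + t \<cdot>\<^sub>m C \<in> carrier_mat d d" using carrier by simp
  have "det (A + t \<cdot>\<^sub>m C) \<noteq> 0" using det_mult[OF A' R(1)] R(2) by auto
  then obtain X X' Y Y' where XY: "X \<in> symmetric_mats d" "X' \<in> symmetric_mats d"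
    "Y \<in> symmetric_mats d" "Y' \<in> symmetric_mats d"
    "X * X' = 1\<^sub>m d" "X' * X = 1\<^sub>m d" "Y * Y' = 1\<^sub>m d" "Y' * Y = 1\<^sub>m d" and AXY: "A + t \<cdot>\<^sub>m C = X * Y"
    using frobenius_symmetric_product[OF A'] by blast
  note c = XY(1-4)[THEN symmetric_mats_carrier]
  \<comment> \<open>With A + t C = X Y, this identifies X' Y' as its inverse transpose, hence as an
    admissible \<open>D0\<close>.\<close>
  have "transpose_mat (X * Y) * (X' * Y') = Y * ((X * X') * Y')"
    using XY(1-4) by (auto simp: square_assoc square_transpose symmetric_mats_def simp del: XY)
  also have "\<dots> = 1\<^sub>m d" unfolding XY(5) using c XY(7) by simp
  finally have "transpose_mat (X * Y) * (X' * Y') = 1\<^sub>m d" .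
  then have H1: "H = upper_unit d ((- t) \<cdot>\<^sub>m 1\<^sub>m d) * (lower_unit d (C * R) *
        (four_block_mat (X * Y) (0\<^sub>m d d) (0\<^sub>m d d) (X' * Y') * upper_unit d (R * (B + t \<cdot>\<^sub>m D))))"
    using eq[of "X' * Y'"] c unfolding AXY by simp
  have "1\<^sub>m d + - 1\<^sub>m d + M = M" if "M \<in> carrier_mat d d" for M :: "real mat"
    using that by (intro eq_matI) auto
  then have "four_block_mat (X * Y) (0\<^sub>m d d) (0\<^sub>m d d) (X' * Y') =
      upper_unit d X * (lower_unit d (- X') * (upper_unit d (X + - Y') *
      (lower_unit d Y * upper_unit d (- Y'))))"
    using symplectic_block_diagonal_factor[of X X' Y Y' "1\<^sub>m d"] c XY by simp
  then have "H = upper_unit d ((- t) \<cdot>\<^sub>m 1\<^sub>m d) * (lower_unit d (C * R) * (upper_unit d X *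
      (lower_unit d (- X') * (upper_unit d (X + - Y') * (lower_unit d Y * upper_unit d (- Y' + R * (B + t \<cdot>\<^sub>m D)))))))"
    unfolding H1 using c sym[THEN symmetric_mats_carrier]
    by (simp add: double_assoc upper_unit_carrier lower_unit_carrier upper_unit_add[of "- Y'"])
  then show ?thesis
    by (rule that[rotated])
      (simp add: XY(1-4) sym symmetric_mats_add symmetric_mats_uminus smult_one_symmetric)
qed

lemma symplectic_nine_factors:
  assumes "Q \<in> symplectic d"
  shows "\<exists>U :: nat \<Rightarrow> real mat. (\<forall>i\<in>{1..9}. U i \<in> unit_triangular_symplectic d) \<and>
    Q = U 9 * U 8 * U 7 * U 6 * U 5 * U 4 * U 3 * U 2 * U 1"
proof -
  obtain S1 S2 S3 S4 S5 S6 S7 where S: "{S1, S2, S3, S4, S5, S6, S7} \<subseteq> symmetric_mats d"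
    "Q = upper_unit d S7 * (lower_unit d S6 * (upper_unit d S5 * (lower_unit d S4 *
      (upper_unit d S3 * (lower_unit d S2 * upper_unit d S1)))))"
    using symplectic_seven_factors[OF assms] .
  \<comment> \<open>The entry at index 0 is a dummy, as the indices start at 1; two identity factors
    extend the seven to nine.\<close>
  let ?U = "(!) [1\<^sub>m 0, upper_unit d S1, lower_unit d S2, upper_unit d S3, lower_unit d S4, upper_unit d S5,
    lower_unit d S6, upper_unit d S7, upper_unit d (0\<^sub>m d d), upper_unit d (0\<^sub>m d d)]"
  have "{1..9} = {1, 2, 3, 4, 5, 6, 7, 8, 9 :: nat}" by auto
  then have "\<forall>i\<in>{1..9}. ?U i \<in> unit_triangular_symplectic d"
    using S(1) by (simp add: unit_triangular_symplectic_def symmetric_mats_zero)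
  moreover have "{S1, S2, S3, S4, S5, S6, S7} \<subseteq> carrier_mat d d"
    using S(1) symmetric_mats_carrier by blast
  then have "Q = ?U 9 * ?U 8 * ?U 7 * ?U 6 * ?U 5 * ?U 4 * ?U 3 * ?U 2 * ?U 1"
    by (simp add: S(2) upper_unit_zero left_mult_one_mat[of _ "2 * d" "2 * d"] double_assoc upper_unit_carrier lower_unit_carrier)
  ultimately show ?thesis by blast
qed

text \<open>Of twelve factors, three pairs of neighbours have the same type and merge, which leaves
  nine beginning with an upper one. A lower factor with zero block in front gives the alternating
  pattern of length ten.\<close>

lemma ten_factor_regroup:
  assumes "T \<in> carrier_mat d d" "W \<in> carrier_mat d d" "P \<in> carrier_mat d d" "S \<in> carrier_mat d d"
    "P' \<in> carrier_mat d d" "S' \<in> carrier_mat d d" "X \<in> carrier_mat d d" "X' \<in> carrier_mat d d"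
    "V \<in> carrier_mat d d" "Y \<in> carrier_mat d d" "Y' \<in> carrier_mat d d" "Z \<in> carrier_mat d d"
  shows "upper_unit d T * (lower_unit d W *
      (((lower_unit d P * (upper_unit d S * (lower_unit d P' * upper_unit d S'))) *
      (upper_unit d X * (lower_unit d X' * (upper_unit d V * (lower_unit d Y * upper_unit d Y'))))) * upper_unit d Z)) =
    lower_unit d (0\<^sub>m d d) * upper_unit d T * lower_unit d (W + P) * upper_unit d S * lower_unit d P' *
      upper_unit d (S' + X) * lower_unit d X' * upper_unit d V * lower_unit d Y * upper_unit d (Y' + Z)"
  using assms
  by (simp add: double_assoc upper_unit_carrier lower_unit_carrier lower_unit_zero
      left_mult_one_mat[of _ "2 * d" "2 * d"] upper_unit_add lower_unit_add)

section \<open>Action on vectors and transitivity\<close>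

lemma upper_unit_mult_vec:
  assumes "S \<in> carrier_mat d d" "x \<in> carrier_vec d" "y \<in> carrier_vec d"
  shows "upper_unit d S *\<^sub>v (x @\<^sub>v y) = (x + S *\<^sub>v y) @\<^sub>v y"
  unfolding upper_unit_def using assms by (subst four_block_mat_mult_vec[of _ d d _ d _ d]) auto

lemma lower_unit_mult_vec:
  assumes "S \<in> carrier_mat d d" "x \<in> carrier_vec d" "y \<in> carrier_vec d"
  shows "lower_unit d S *\<^sub>v (x @\<^sub>v y) = x @\<^sub>v (S *\<^sub>v x + y)"
  unfolding lower_unit_def using assms by (subst four_block_mat_mult_vec[of _ d d _ d _ d]) auto

lemma append_carrier_double: "x \<in> carrier_vec d \<Longrightarrow> y \<in> carrier_vec d \<Longrightarrow> x @\<^sub>v y \<in> carrier_vec (2 * d)"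
  by (simp add: mult_2)

lemma unit_vec_append: "0 < d \<Longrightarrow> unit_vec (2 * d) 0 = unit_vec d 0 @\<^sub>v (0\<^sub>v d :: real vec)"
  by (intro eq_vecI) (auto simp: unit_vec_def)

text \<open>If the first half x of the target is nonzero, three triangular factors suffice; a target
  with vanishing first half is reached by one more factor.\<close>

lemma symplectic_transitive:
  assumes d: "0 < d" and v: "v \<in> carrier_vec (2 * d)" "v \<noteq> 0\<^sub>v (2 * d)"
  obtains Q where "Q \<in> symplectic d" "Q *\<^sub>v unit_vec (2 * d) 0 = v"
proof -
  have *: "\<exists>Q\<in>symplectic d. Q *\<^sub>v unit_vec (2 * d) 0 = x @\<^sub>v y"
    if x: "x \<in> carrier_vec d" "x \<noteq> 0\<^sub>v d" and y: "y \<in> carrier_vec d" for x y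
  proof -
    let ?e = "unit_vec d 0 :: real vec"
    have e: "?e \<in> carrier_vec d" "?e \<noteq> 0\<^sub>v d" using d by (auto simp: vec_eq_iff)
    obtain S where S: "S \<in> symmetric_mats d" "S *\<^sub>v ?e = x - ?e"
      using symmetric_transport[OF e, of "x - ?e"] x e by auto
    obtain T where T: "T \<in> symmetric_mats d" "T *\<^sub>v x = y - ?e"
      using symmetric_transport[OF x, of "y - ?e"] y e by auto
    note c = S(1)[THEN symmetric_mats_carrier] T(1)[THEN symmetric_mats_carrier]
    \<comment> \<open>The path is (e, 0), (e, e), (x, e), (x, y); the first move makes the second
      half nonzero, as transport of the first half requires.\<close>
    let ?Q = "lower_unit d T * (upper_unit d S * lower_unit d (1\<^sub>m d))"
    have "?Q \<in> symplectic d"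
      using S T by (intro symplectic_mult upper_unit_symplectic lower_unit_symplectic symmetric_mats_one)
    moreover have "?e + (x - ?e) = x" "y - ?e + ?e = y" using x y e by (auto intro!: eq_vecI)
    then have "?Q *\<^sub>v (?e @\<^sub>v 0\<^sub>v d) = x @\<^sub>v y"
      using c e x y
      by (simp add: double_assoc upper_unit_carrier lower_unit_carrier
          upper_unit_mult_vec lower_unit_mult_vec append_carrier_double S T)
    ultimately show ?thesis using unit_vec_append[OF d] by metis
  qed
  let ?x = "vec_first v d" and ?y = "vec_last v d"
  have v_eq: "v = ?x @\<^sub>v ?y" and xy: "?x \<in> carrier_vec d" "?y \<in> carrier_vec d"
    using v by (simp_all add: mult_2)
  show ?thesis
  proof (cases "?x = 0\<^sub>v d")
    case False
    then show ?thesis using *[OF xy(1) False xy(2)] that v_eq by metis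
  next
    case True
    have y0: "?y \<noteq> 0\<^sub>v d"
    proof
      assume "?y = 0\<^sub>v d"
      then have "v = 0\<^sub>v d @\<^sub>v 0\<^sub>v d" using True v_eq by simp
      also have "\<dots> = 0\<^sub>v (2 * d)" by (intro eq_vecI) auto
      finally show False using v(2) by simp
    qed
    \<comment> \<open>The vector (y, y) has a nonzero first half, so it is within reach; an upper
      factor with block -1 then subtracts y from that half.\<close>
    obtain Q where Q: "Q \<in> symplectic d" "Q *\<^sub>v unit_vec (2 * d) 0 = ?y @\<^sub>v ?y"
      using *[OF xy(2) y0 xy(2)] by blast
    have "(upper_unit d (- 1\<^sub>m d) * Q) *\<^sub>v unit_vec (2 * d) 0 = upper_unit d (- 1\<^sub>m d) *\<^sub>v (?y @\<^sub>v ?y)"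
      using Q symplectic_carrier[OF Q(1)]
      by (simp add: double_assoc upper_unit_carrier)
    also have "\<dots> = ?x @\<^sub>v ?y"
      using xy unfolding True by (subst upper_unit_mult_vec) (auto simp: uminus_mult_mat_vec)
    finally show ?thesis
      using that v_eq symplectic_mult[OF upper_unit_symplectic Q(1)] symmetric_mats_uminus[OF symmetric_mats_one]
      by metis
  qed
qed

end

section \<open>The stabilizer of the first unit vector\<close>

context
  fixes n :: nat
begin

abbreviation "pad \<equiv> pad_zero (Suc n)"

lemma pad_carrier: "T \<in> carrier_mat n n \<Longrightarrow> pad T \<in> carrier_mat (Suc n) (Suc n)"
  unfolding pad_zero_def by (simp add: four_block_carrier_mat[of _ 1 1 _ n n, simplified])

lemmas corner_mult = mult_four_block_mat[of _ 1 1 _ n _ n _ _ 1 _ n]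
lemmas corner_transpose = transpose_four_block_mat[of _ 1 1 _ n _ n]
lemmas corner_add = add_four_block_mat[of _ 1 1 _ n _ n]

lemma pad_uminus: "T \<in> carrier_mat n n \<Longrightarrow> pad (- T) = - pad T"
  unfolding pad_zero_def by (intro eq_matI) auto

lemma pad_add: "T \<in> carrier_mat n n \<Longrightarrow> T' \<in> carrier_mat n n \<Longrightarrow> pad (T + T') = pad T + pad T'"
  unfolding pad_zero_def by (simp add: corner_add)

lemma pad_mult: "T \<in> carrier_mat n n \<Longrightarrow> T' \<in> carrier_mat n n \<Longrightarrow> pad T * pad T' = pad (T * T')"
  unfolding pad_zero_def by (simp add: corner_mult)

lemma pad_symmetric: "T \<in> symmetric_mats n \<Longrightarrow> pad T \<in> symmetric_mats (Suc n)"
  using pad_carrier unfolding symmetric_mats_def by (auto simp: pad_zero_def corner_transpose)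

lemma pad_mult_unit_vec: "T \<in> carrier_mat n n \<Longrightarrow> pad T *\<^sub>v unit_vec (Suc n) 0 = 0\<^sub>v (Suc n)"
  unfolding pad_zero_def by (intro eq_vecI) auto

text \<open>\<open>pad\<close> of the identity is the idempotent E in the block diagonal
  factorization, and 1 - E projects onto the first coordinate; this evaluates the diagonal blocks
  obtained there.\<close>

lemma one_plus_pad:
  "T \<in> carrier_mat n n \<Longrightarrow> 1\<^sub>m (Suc n) + - pad (1\<^sub>m n) + pad T =
    four_block_mat (1\<^sub>m 1) (0\<^sub>m 1 n) (0\<^sub>m n 1) T"
  unfolding pad_zero_def by (intro eq_matI) auto

lemma col0_of_mult_unit_vec:
  fixes M :: "real mat"
  assumes "M \<in> carrier_mat (Suc n) (Suc n)" "i < Suc n"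
  shows "M $$ (i, 0) = (M *\<^sub>v unit_vec (Suc n) 0) $ i"
  using assms by simp

text \<open>The first column vanishes, and by symmetry the first row too. This is how the lower LDU
  factor acquires its padded form.\<close>

lemma symmetric_kernel_unit_vec_pad:
  assumes W: "W \<in> symmetric_mats (Suc n)" and ker: "W *\<^sub>v unit_vec (Suc n) 0 = 0\<^sub>v (Suc n)"
  obtains T where "T \<in> symmetric_mats n" "W = pad T"
proof
  let ?T = "mat n n (\<lambda>(i, j). W $$ (Suc i, Suc j))"
  have c: "W \<in> carrier_mat (Suc n) (Suc n)" using W by (rule symmetric_mats_carrier)
  have sym: "W $$ (i, j) = W $$ (j, i)" if "i < Suc n" "j < Suc n" for i j
    using W c that index_transpose_mat(1)[of i W j] by (auto simp: symmetric_mats_def)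
  have col: "W $$ (i, 0) = 0" if "i < Suc n" for i
    using col0_of_mult_unit_vec[OF c that] that by (simp add: ker)
  have col': "W $$ (0, i) = 0" if "i < Suc n" for i using sym[of 0 i] col[OF that] that by simp
  show "?T \<in> symmetric_mats n" by (auto simp: symmetric_mats_def sym intro!: eq_matI)
  show "W = pad ?T"
    unfolding pad_zero_def using c col col'
    by (intro eq_matI) (auto simp: less_Suc_eq_0_disj)
qed

lemma fixes_unit_vec_corner:
  fixes A :: "real mat"
  assumes A: "A \<in> carrier_mat (Suc n) (Suc n)" and fix0: "A *\<^sub>v unit_vec (Suc n) 0 = unit_vec (Suc n) 0"
  obtains a A2 where "a \<in> carrier_mat 1 n" "A2 \<in> carrier_mat n n"
    "A = four_block_mat (1\<^sub>m 1) a (0\<^sub>m n 1) A2"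
proof
  let ?a = "mat 1 n (\<lambda>(i, j). A $$ (0, Suc j))" and ?A2 = "mat n n (\<lambda>(i, j). A $$ (Suc i, Suc j))"
  have col: "A $$ (i, 0) = (if i = 0 then 1 else 0)" if "i < Suc n" for i
    using col0_of_mult_unit_vec[OF A that] that by (simp add: fix0)
  show "A = four_block_mat (1\<^sub>m 1) ?a (0\<^sub>m n 1) ?A2"
    using A col by (intro eq_matI) (auto simp: less_Suc_eq_0_disj)
qed auto

text \<open>\<open>A\<close> has first column e, so A = (1, a; 0, A2) splits into a shear and diag
  (1, A2). The shear factorization handles the first and the idempotent version of Frobenius'
  factorization the second, both with \<open>pad (1\<^sub>m n)\<close>.\<close>

lemma corner_symplectic_diagonal:
  fixes A :: "real mat"
  assumes A: "A \<in> carrier_mat (Suc n) (Suc n)" "det A \<noteq> 0"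
    and fix0: "A *\<^sub>v unit_vec (Suc n) 0 = unit_vec (Suc n) 0"
  obtains D0 S S' X X' Y Y' where
    "D0 \<in> carrier_mat (Suc n) (Suc n)" "transpose_mat A * D0 = 1\<^sub>m (Suc n)"
    "{S, S'} \<subseteq> symmetric_mats (Suc n)" "{X, X', Y, Y'} \<subseteq> symmetric_mats n"
    "four_block_mat A (0\<^sub>m (Suc n) (Suc n)) (0\<^sub>m (Suc n) (Suc n)) D0 =
      (lower_unit (Suc n) (pad (1\<^sub>m n)) * (upper_unit (Suc n) S * (lower_unit (Suc n) (- pad (1\<^sub>m n)) * upper_unit (Suc n) S'))) *
      (upper_unit (Suc n) (pad X) * (lower_unit (Suc n) (- pad X') * (upper_unit (Suc n) (pad X + - pad Y') *
        (lower_unit (Suc n) (pad Y) * upper_unit (Suc n) (- pad Y')))))"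
proof -
  let ?d = "Suc n" and ?T = transpose_mat
  obtain a A2 where a: "a \<in> carrier_mat 1 n" "A2 \<in> carrier_mat n n"
    and A_eq: "A = four_block_mat (1\<^sub>m 1) a (0\<^sub>m n 1) A2"
    using fixes_unit_vec_corner[OF A(1) fix0] .
  have "det A = det A2"
    unfolding A_eq using a by (subst det_four_block_mat_lower_left_zero[of _ 1 _ n]) auto
  then have "det A2 \<noteq> 0" using A(2) by simp
  then obtain X X' Y Y' where XY: "X \<in> symmetric_mats n" "X' \<in> symmetric_mats n"
    "Y \<in> symmetric_mats n" "Y' \<in> symmetric_mats n"
    "X * X' = 1\<^sub>m n" "X' * X = 1\<^sub>m n" "Y * Y' = 1\<^sub>m n" "Y' * Y = 1\<^sub>m n" "A2 = X * Y"
    using frobenius_symmetric_product[OF a(2)] by blast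
  note c = XY(1-4)[THEN symmetric_mats_carrier]
  have tr: "?T X = X" "?T Y = Y" "?T X' = X'" "?T Y' = Y'" using XY(1-4) by (auto simp: symmetric_mats_def)
  \<comment> \<open>As A2 = X Y has inverse Y' X', this is s = -a A2^-1, so the shear (1, -s; 0, 1)
    times diag (1, A2) is \<open>A\<close>.\<close>
  define s where "s = - (a * (Y' * X'))"
  have s: "s \<in> carrier_mat 1 n" unfolding s_def using a c by simp
  have sA2: "- s * A2 = a"
  proof -
    have "- s * A2 = a * (Y' * ((X' * X) * Y))"
      unfolding s_def XY(9) using a(1) c by (simp add: assoc_mult_mat[of _ _ n _ n _ n])
    then show ?thesis unfolding XY(6) using a(1) c XY(8) by simp
  qed
  have A2T: "?T A2 * (X' * Y') = 1\<^sub>m n"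
  proof -
    have "?T A2 * (X' * Y') = Y * ((X * X') * Y')"
      unfolding XY(9) using c tr by (simp add: transpose_mult[of _ n n _ n] assoc_mult_mat[of _ n n _ n _ n])
    then show ?thesis unfolding XY(5) using c XY(7) by simp
  qed
  \<comment> \<open>All entries of \<open>S\<close> lie in the first row and first column, which
    multiplication by \<open>?P\<close> on both sides erases; hence P S P = 0, while S P retains the
    row \<open>s\<close>.\<close>
  define S where "S = four_block_mat (0\<^sub>m 1 1) s (?T s) (0\<^sub>m n n)"
  let ?P = "pad (1\<^sub>m n)"
  have P: "?P \<in> carrier_mat ?d ?d" by (simp add: pad_carrier)
  have S: "S \<in> symmetric_mats ?d"
    unfolding symmetric_mats_def S_def using s
    by (auto simp: corner_transpose four_block_carrier_mat[of _ 1 1 _ n n, simplified])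
  note Sc = S[THEN symmetric_mats_carrier]
  have PS: "?P * S = four_block_mat (0\<^sub>m 1 1) (0\<^sub>m 1 n) (?T s) (0\<^sub>m n n)"
    and SP: "S * ?P = four_block_mat (0\<^sub>m 1 1) s (0\<^sub>m n 1) (0\<^sub>m n n)"
    unfolding pad_zero_def S_def using s by (simp_all add: corner_mult)
  have PSP: "?P * (S * ?P) = 0\<^sub>m ?d ?d"
    unfolding SP unfolding pad_zero_def using s by (simp add: corner_mult)
  have one_PS: "1\<^sub>m ?d + ?P * S = four_block_mat (1\<^sub>m 1) (0\<^sub>m 1 n) (?T s) (1\<^sub>m n)"
    and one_SP: "1\<^sub>m ?d + - (S * ?P) = four_block_mat (1\<^sub>m 1) (- s) (0\<^sub>m n 1) (1\<^sub>m n)"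
    unfolding PS SP using s by (auto intro!: eq_matI)
  let ?S' = "- (S + S * (?P * S))"
  have "?T (S * (?P * S)) = S * (?P * S)"
  proof -
    have "?T ?P = ?P" "?T S = S"
      using pad_symmetric[OF symmetric_mats_one] S by (auto simp: symmetric_mats_def)
    then show ?thesis using P Sc
      by (simp add: transpose_mult[of _ ?d ?d _ ?d] assoc_mult_mat[of _ ?d ?d _ ?d _ ?d])
  qed
  then have "S * (?P * S) \<in> symmetric_mats ?d" using P Sc by (simp add: symmetric_mats_def)
  then have S': "?S' \<in> symmetric_mats ?d" using S by (intro symmetric_mats_uminus symmetric_mats_add)
  \<comment> \<open>This is A^-T, read off from A^-1 = (1, s; 0, A2^-1).\<close>
  let ?D0 = "four_block_mat (1\<^sub>m 1) (0\<^sub>m 1 n) (?T s) (X' * Y')"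
  have D0: "?D0 \<in> carrier_mat ?d ?d" using c four_block_carrier_mat[of "1\<^sub>m 1" 1 1 "X' * Y'" n n] by simp
  have "?T a + ?T A2 * ?T s = 0\<^sub>m n 1"
  proof -
    have "?T (- s * A2) = ?T a" by (simp only: sA2)
    then have "?T a = - (?T A2 * ?T s)"
      using s a(2) by (simp add: transpose_uminus transpose_mult[of _ 1 n _ n])
    then show ?thesis using s a(2) by (auto intro!: eq_matI)
  qed
  then have AD0: "?T A * ?D0 = 1\<^sub>m ?d"
    unfolding A_eq using a c s A2T by (simp add: corner_mult corner_transpose)
  have "four_block_mat A (0\<^sub>m ?d ?d) (0\<^sub>m ?d ?d) ?D0 =
    four_block_mat (1\<^sub>m ?d + - (S * ?P)) (0\<^sub>m ?d ?d) (0\<^sub>m ?d ?d) (1\<^sub>m ?d + ?P * S) *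
    four_block_mat (1\<^sub>m ?d + - ?P + pad X * pad Y) (0\<^sub>m ?d ?d) (0\<^sub>m ?d ?d) (1\<^sub>m ?d + - ?P + pad X' * pad Y')"
  proof -
    \<comment> \<open>\<open>?U\<close> and \<open>?U'\<close> are the blocks of the shear,
      \<open>?V\<close> and \<open>?V'\<close> those of the padded Frobenius factorization.\<close>
    let ?U = "four_block_mat (1\<^sub>m 1) (- s) (0\<^sub>m n 1) (1\<^sub>m n)" and ?V = "four_block_mat (1\<^sub>m 1) (0\<^sub>m 1 n) (0\<^sub>m n 1) A2"
    let ?U' = "four_block_mat (1\<^sub>m 1) (0\<^sub>m 1 n) (?T s) (1\<^sub>m n)" and ?V' = "four_block_mat (1\<^sub>m 1) (0\<^sub>m 1 n) (0\<^sub>m n 1) (X' * Y')"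
    have carrier: "?U \<in> carrier_mat ?d ?d" "?V \<in> carrier_mat ?d ?d" "?U' \<in> carrier_mat ?d ?d" "?V' \<in> carrier_mat ?d ?d"
      using a c s four_block_carrier_mat[of "1\<^sub>m 1" 1 1 _ n n] by auto
    have "A = ?U * ?V" "?D0 = ?U' * ?V'"
      unfolding A_eq using a c s sA2 by (simp_all add: corner_mult del: uminus_mult_left_mat)
    then have "four_block_mat A (0\<^sub>m ?d ?d) (0\<^sub>m ?d ?d) ?D0 =
      four_block_mat ?U (0\<^sub>m ?d ?d) (0\<^sub>m ?d ?d) ?U' * four_block_mat ?V (0\<^sub>m ?d ?d) (0\<^sub>m ?d ?d) ?V'"
      using carrier by (simp add: square_mult square_units)
    moreover have "1\<^sub>m ?d + - ?P + pad X * pad Y = ?V" "1\<^sub>m ?d + - ?P + pad X' * pad Y' = ?V'"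
      using c by (simp_all add: pad_mult one_plus_pad XY(9))
    ultimately show ?thesis by (simp only: one_SP one_PS)
  qed
  also have "\<dots> =
      (lower_unit ?d ?P * (upper_unit ?d S * (lower_unit ?d (- ?P) * upper_unit ?d ?S'))) *
      (upper_unit ?d (pad X) * (lower_unit ?d (- pad X') * (upper_unit ?d (pad X + - pad Y') *
        (lower_unit ?d (pad Y) * upper_unit ?d (- pad Y')))))"
    using P c XY
    by (subst symplectic_shear_factor[OF P Sc PSP],
        subst symplectic_block_diagonal_factor[of "pad X" _ "pad X'" "pad Y" "pad Y'" ?P])
      (auto simp: pad_carrier pad_mult)
  finally show ?thesis
    using that[OF D0 AD0, of S ?S' X X' Y Y'] S S' XY(1-4) by simp
qed

text \<open>Fixing the first unit vector e means A e = e and C e = 0. The shifted block A + t C and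
  its inverse R then fix e, so the symmetric matrix C R kills e and is padded.\<close>

lemma stabilizer_ten_factors:
  assumes G: "G \<in> symplectic (Suc n)" and fix0: "G *\<^sub>v unit_vec (2 * Suc n) 0 = unit_vec (2 * Suc n) 0"
  obtains S1 S2 S3 S4 S5 S6 S7 S8 S9 S10 where
    "{S1, S3, S5, S7, S9} \<subseteq> symmetric_mats (Suc n)" "{S2, S4, S6, S8, S10} \<subseteq> symmetric_mats n"
    "G = lower_unit (Suc n) (pad S10) * upper_unit (Suc n) S9 * lower_unit (Suc n) (pad S8) *
      upper_unit (Suc n) S7 * lower_unit (Suc n) (pad S6) * upper_unit (Suc n) S5 *
      lower_unit (Suc n) (pad S4) * upper_unit (Suc n) S3 * lower_unit (Suc n) (pad S2) * upper_unit (Suc n) S1"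
proof -
  let ?d = "Suc n"
  let ?e = "unit_vec ?d 0 :: real vec"
  let ?P = "pad (1\<^sub>m n)"
  obtain A B C D where carrier: "A \<in> carrier_mat ?d ?d" "B \<in> carrier_mat ?d ?d" "C \<in> carrier_mat ?d ?d" "D \<in> carrier_mat ?d ?d"
    and G_eq: "G = four_block_mat A B C D"
    using square_blocks_exist[OF symplectic_carrier[OF G]] .
  have "(A *\<^sub>v ?e) @\<^sub>v (C *\<^sub>v ?e) = G *\<^sub>v (?e @\<^sub>v 0\<^sub>v ?d)"
  proof -
    have "A *\<^sub>v ?e + B *\<^sub>v 0\<^sub>v ?d = A *\<^sub>v ?e" "C *\<^sub>v ?e + D *\<^sub>v 0\<^sub>v ?d = C *\<^sub>v ?e"
      using carrier by (auto intro!: eq_vecI)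
    then show ?thesis
      unfolding G_eq using carrier by (subst four_block_mat_mult_vec[of _ ?d ?d _ ?d _ ?d]) auto
  qed
  also have "\<dots> = ?e @\<^sub>v 0\<^sub>v ?d" using fix0 unit_vec_append[of ?d] by simp
  finally have AC: "A *\<^sub>v ?e = ?e" "C *\<^sub>v ?e = 0\<^sub>v ?d"
    using carrier by (auto simp: append_vec_eq[of _ ?d])
  obtain t R where R: "R \<in> carrier_mat ?d ?d" "(A + t \<cdot>\<^sub>m C) * R = 1\<^sub>m ?d" "R * (A + t \<cdot>\<^sub>m C) = 1\<^sub>m ?d"
    and sym: "C * R \<in> symmetric_mats ?d" "R * (B + t \<cdot>\<^sub>m D) \<in> symmetric_mats ?d"
    and eq: "\<And>D0. D0 \<in> carrier_mat ?d ?d \<Longrightarrow> transpose_mat (A + t \<cdot>\<^sub>m C) * D0 = 1\<^sub>m ?d \<Longrightarrow>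
      G = upper_unit ?d ((- t) \<cdot>\<^sub>m 1\<^sub>m ?d) * (lower_unit ?d (C * R) *
        (four_block_mat (A + t \<cdot>\<^sub>m C) (0\<^sub>m ?d ?d) (0\<^sub>m ?d ?d) D0 * upper_unit ?d (R * (B + t \<cdot>\<^sub>m D))))"
    using symplectic_ULDU[OF carrier] G unfolding G_eq by blast
  let ?A = "A + t \<cdot>\<^sub>m C"
  have A': "?A \<in> carrier_mat ?d ?d" using carrier by simp
  have "?A *\<^sub>v ?e = A *\<^sub>v ?e + t \<cdot>\<^sub>v (C *\<^sub>v ?e)"
    using carrier by (auto intro!: eq_vecI)
  then have Ae: "?A *\<^sub>v ?e = ?e" unfolding AC by (auto intro!: eq_vecI)
  have "R *\<^sub>v ?e = (R * ?A) *\<^sub>v ?e" using R(1) A' Ae by (simp add: assoc_mult_mat_vec[of _ ?d ?d _ ?d])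
  then have "R *\<^sub>v ?e = ?e" unfolding R(3) by simp
  then have "(C * R) *\<^sub>v ?e = 0\<^sub>v ?d"
    using carrier R(1) AC(2) by (simp add: assoc_mult_mat_vec[of _ ?d ?d _ ?d])
  then obtain W where W: "W \<in> symmetric_mats n" "C * R = pad W"
    using symmetric_kernel_unit_vec_pad[OF sym(1)] by blast
  have "det ?A \<noteq> 0" using det_mult[OF A' R(1)] R(2) by auto
  then obtain D0 S S' X X' Y Y' where D0: "D0 \<in> carrier_mat ?d ?d" "transpose_mat ?A * D0 = 1\<^sub>m ?d"
    and S: "{S, S'} \<subseteq> symmetric_mats ?d" and XY: "{X, X', Y, Y'} \<subseteq> symmetric_mats n"
    and diag: "four_block_mat ?A (0\<^sub>m ?d ?d) (0\<^sub>m ?d ?d) D0 =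
      (lower_unit ?d ?P * (upper_unit ?d S * (lower_unit ?d (- ?P) * upper_unit ?d S'))) *
      (upper_unit ?d (pad X) * (lower_unit ?d (- pad X') * (upper_unit ?d (pad X + - pad Y') *
        (lower_unit ?d (pad Y) * upper_unit ?d (- pad Y')))))"
    using corner_symplectic_diagonal[OF A' _ Ae] by metis
  let ?Z = "R * (B + t \<cdot>\<^sub>m D)"
  have padZ: "pad (0\<^sub>m n n) = 0\<^sub>m ?d ?d" unfolding pad_zero_def by (auto intro!: eq_matI)
  have c: "W \<in> carrier_mat n n" "X \<in> carrier_mat n n" "X' \<in> carrier_mat n n" "Y \<in> carrier_mat n n" "Y' \<in> carrier_mat n n"
    "S \<in> carrier_mat ?d ?d" "S' \<in> carrier_mat ?d ?d" "?Z \<in> carrier_mat ?d ?d"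
    using W(1) XY S sym(2) by (auto intro: symmetric_mats_carrier)
  have pads: "pad (0\<^sub>m n n) = 0\<^sub>m ?d ?d" "pad (W + 1\<^sub>m n) = pad W + ?P" "pad (- 1\<^sub>m n) = - ?P" "pad (- X') = - pad X'"
    using c by (simp_all add: padZ pad_add pad_uminus)
  show ?thesis
  proof (rule that)
    \<comment> \<open>The blocks are listed as S1, S3, S5, S7, S9 and then S2, S4, S6, S8, S10. S1,
      S5 and S8 are sums because of the merged neighbours, and the zero block S10 stands for the
      leading identity factor.\<close>
    show "{- pad Y' + ?Z, pad X + - pad Y', S' + pad X, S, (- t) \<cdot>\<^sub>m 1\<^sub>m ?d} \<subseteq> symmetric_mats ?d"
      using S XY sym(2)
      by (simp add: symmetric_mats_add symmetric_mats_uminus pad_symmetric smult_one_symmetric)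
    show "{Y, - X', - 1\<^sub>m n, W + 1\<^sub>m n, 0\<^sub>m n n} \<subseteq> symmetric_mats n"
      using XY W(1)
      by (simp add: symmetric_mats_add symmetric_mats_uminus symmetric_mats_zero symmetric_mats_one)
    have "G = upper_unit ?d ((- t) \<cdot>\<^sub>m 1\<^sub>m ?d) * (lower_unit ?d (pad W) *
        (((lower_unit ?d ?P * (upper_unit ?d S * (lower_unit ?d (- ?P) * upper_unit ?d S'))) *
      (upper_unit ?d (pad X) * (lower_unit ?d (- pad X') * (upper_unit ?d (pad X + - pad Y') *
        (lower_unit ?d (pad Y) * upper_unit ?d (- pad Y')))))) * upper_unit ?d ?Z))"
      using eq[OF D0] unfolding diag W(2) .
    also have "\<dots> = lower_unit ?d (pad (0\<^sub>m n n)) * upper_unit ?d ((- t) \<cdot>\<^sub>m 1\<^sub>m ?d) * lower_unit ?d (pad (W + 1\<^sub>m n)) *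
      upper_unit ?d S * lower_unit ?d (pad (- 1\<^sub>m n)) * upper_unit ?d (S' + pad X) *
      lower_unit ?d (pad (- X')) * upper_unit ?d (pad X + - pad Y') * lower_unit ?d (pad Y) * upper_unit ?d (- pad Y' + ?Z)"
      unfolding pads using c by (intro ten_factor_regroup) (simp_all add: pad_carrier)
    finally show "G = lower_unit ?d (pad (0\<^sub>m n n)) * upper_unit ?d ((- t) \<cdot>\<^sub>m 1\<^sub>m ?d) * lower_unit ?d (pad (W + 1\<^sub>m n)) *
      upper_unit ?d S * lower_unit ?d (pad (- 1\<^sub>m n)) * upper_unit ?d (S' + pad X) *
      lower_unit ?d (pad (- X')) * upper_unit ?d (pad X + - pad Y') * lower_unit ?d (pad Y) * upper_unit ?d (- pad Y' + ?Z)" .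
  qed
qed

text \<open>Together with its lower counterpart this serves the converse inclusion: each of the ten
  factors fixes the first unit vector, hence so does their product.\<close>

lemma upper_unit_fixes_unit_vec:
  assumes "S \<in> carrier_mat (Suc n) (Suc n)"
  shows "upper_unit (Suc n) S *\<^sub>v unit_vec (2 * Suc n) 0 = unit_vec (2 * Suc n) 0"
  unfolding unit_vec_append[OF zero_less_Suc] using assms
  by (subst upper_unit_mult_vec) (auto intro!: eq_vecI)

lemma lower_unit_pad_fixes_unit_vec:
  assumes "T \<in> carrier_mat n n"
  shows "lower_unit (Suc n) (pad T) *\<^sub>v unit_vec (2 * Suc n) 0 = unit_vec (2 * Suc n) 0"
  unfolding unit_vec_append[OF zero_less_Suc] using assms
  by (subst lower_unit_mult_vec) (auto simp: pad_carrier pad_mult_unit_vec)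

end

section \<open>Singular symplectic matrices as conjugates of stabilizer elements\<close>

text \<open>The image of the first unit vector under \<open>Q\<close> is a nonzero fixed vector of
  the conjugate, so 1 is an eigenvalue.\<close>

lemma conjugate_fixing_in_SPS:
  assumes d: "0 < d" and Q: "Q \<in> symplectic d"
    and Qinv: "Qinv \<in> carrier_mat (2 * d) (2 * d)" "Q * Qinv = 1\<^sub>m (2 * d)" "Qinv * Q = 1\<^sub>m (2 * d)"
    and K: "K \<in> symplectic d" "K *\<^sub>v unit_vec (2 * d) 0 = unit_vec (2 * d) 0"
  shows "Q * K * Qinv \<in> SPS d"
proof -
  let ?m = "2 * d"
  let ?e = "unit_vec ?m 0 :: real vec"
  note Qc = symplectic_carrier[OF Q] and Kc = symplectic_carrier[OF K(1)]
  obtain Q' where Q': "Q' \<in> symplectic d" "Q * Q' = 1\<^sub>m ?m" using symplectic_inverse[OF Q] by blast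
  \<comment> \<open>\<open>Qinv\<close> is only assumed to be an inverse; uniqueness of inverses
    identifies it with the symplectic one.\<close>
  have "Qinv = Qinv * Q * Q'"
    using Qinv(1) Qc symplectic_carrier[OF Q'(1)] Q'(2) by (simp add: assoc_mult_mat[of _ ?m ?m _ ?m _ ?m])
  then have "Qinv = Q'" using Qinv(3) symplectic_carrier[OF Q'(1)] by simp
  then have H: "Q * K * Qinv \<in> symplectic d" using symplectic_mult Q K Q' by blast
  let ?v = "Q *\<^sub>v ?e"
  have e: "?e \<in> carrier_vec ?m" by simp
  have v: "?v \<in> carrier_vec ?m" using Qc by simp
  have Qv: "Qinv *\<^sub>v ?v = ?e"
    using Qinv Qc by (simp flip: assoc_mult_mat_vec[of _ ?m ?m _ ?m])
  have "?v \<noteq> 0\<^sub>v ?m"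
  proof
    assume "?v = 0\<^sub>v ?m"
    then have "?e = Qinv *\<^sub>v 0\<^sub>v ?m" using Qv by simp
    also have "\<dots> = 0\<^sub>v ?m" using Qinv(1) by (intro eq_vecI) auto
    finally have "?e $ 0 = 0\<^sub>v ?m $ 0" by simp
    then show False using d by simp
  qed
  moreover have "(Q * K * Qinv) *\<^sub>v ?v = ?v"
  proof -
    have "(Q * K * Qinv) *\<^sub>v ?v = (Q * K) *\<^sub>v (Qinv *\<^sub>v ?v)"
      using Qc Kc Qinv(1) v by (intro assoc_mult_mat_vec[of _ ?m ?m _ ?m]) auto
    also have "\<dots> = ?v"
      unfolding Qv by (subst assoc_mult_mat_vec[OF Qc Kc e]) (simp only: K(2))
    finally show ?thesis .
  qed
  then have "(Q * K * Qinv - 1\<^sub>m ?m) *\<^sub>v ?v = 0\<^sub>v ?m"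
    using symplectic_carrier[OF H] v by (subst minus_mult_distrib_mat_vec[of _ ?m ?m]) auto
  ultimately have "det (Q * K * Qinv - 1\<^sub>m ?m) = 0"
    using v symplectic_carrier[OF H] by (subst det_0_iff_vec_prod_zero[of _ ?m]) (auto intro: minus_carrier_mat)
  then show ?thesis using H by (simp add: SPS_def)
qed

text \<open>Singularity yields a nonzero fixed vector v of \<open>H\<close>. By transitivity some
  symplectic \<open>Q\<close> maps the first unit vector to v, and Q^-1 H Q fixes that unit
  vector.\<close>

lemma SPS_conjugate_fixing:
  assumes d: "0 < d" and H: "H \<in> SPS d"
  obtains Q Qinv G where "Q \<in> symplectic d" "Qinv \<in> carrier_mat (2 * d) (2 * d)"
    "Q * Qinv = 1\<^sub>m (2 * d)" "Qinv * Q = 1\<^sub>m (2 * d)" "G \<in> symplectic d"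
    "G *\<^sub>v unit_vec (2 * d) 0 = unit_vec (2 * d) 0" "H = Q * G * Qinv"
proof -
  let ?m = "2 * d"
  have Hs: "H \<in> symplectic d" "det (H - 1\<^sub>m ?m) = 0" using H by (auto simp: SPS_def)
  note Hc = symplectic_carrier[OF Hs(1)]
  obtain v where v: "v \<in> carrier_vec ?m" "v \<noteq> 0\<^sub>v ?m" "(H - 1\<^sub>m ?m) *\<^sub>v v = 0\<^sub>v ?m"
    using det_0_iff_vec_prod_zero[OF minus_carrier_mat[OF one_carrier_mat], of H] Hs(2) by blast
  have "H *\<^sub>v v - v = 0\<^sub>v ?m"
    using v(3) minus_mult_distrib_mat_vec[OF Hc one_carrier_mat v(1)] v(1) by simp
  then have Hv: "H *\<^sub>v v = v"
    using v(1) Hc by (auto simp: vec_eq_iff)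
  obtain Q where Q: "Q \<in> symplectic d" "Q *\<^sub>v unit_vec ?m 0 = v"
    using symplectic_transitive[OF d v(1,2)] .
  obtain Q' where Q': "Q' \<in> symplectic d" "Q * Q' = 1\<^sub>m ?m" "Q' * Q = 1\<^sub>m ?m"
    using symplectic_inverse[OF Q(1)] .
  note Qc = symplectic_carrier[OF Q(1)] and Qc' = symplectic_carrier[OF Q'(1)]
  let ?e = "unit_vec ?m 0 :: real vec"
  have e: "?e \<in> carrier_vec ?m" by simp
  have Qv: "Q' *\<^sub>v v = ?e"
    unfolding Q(2)[symmetric] by (subst assoc_mult_mat_vec[OF Qc' Qc e, symmetric]) (simp add: Q'(3))
  let ?G = "Q' * (H * Q)"
  have "?G *\<^sub>v ?e = Q' *\<^sub>v ((H * Q) *\<^sub>v ?e)"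
    using Qc' Hc Qc by (intro assoc_mult_mat_vec[of _ ?m ?m _ ?m]) auto
  also have "\<dots> = ?e" by (subst assoc_mult_mat_vec[OF Hc Qc e]) (simp only: Q(2) Hv Qv)
  finally have G: "?G *\<^sub>v ?e = ?e" .
  have "Q * ?G * Q' = (Q * Q') * H * (Q * Q')"
    using Qc Qc' Hc by (simp add: assoc_mult_mat[of _ ?m ?m _ ?m _ ?m] double_closed)
  then have "H = Q * ?G * Q'" unfolding Q'(2) using Hc by simp
  moreover have "?G \<in> symplectic d" using symplectic_mult Q(1) Q'(1) Hs(1) by blast
  ultimately show ?thesis using that Q(1) Qc' Q'(2,3) G by blast
qed

theorem corollary6:
  fixes d :: nat
  assumes "d \<ge> 1"
  shows "SPS d =
      {Q * (M 10 * M 9 * M 8 * M 7 * M 6 * M 5 * M 4 * M 3 * M 2 * M 1) * Qinv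
       | (Q :: real mat) (Qinv :: real mat) (M :: nat \<Rightarrow> real mat) (S :: nat \<Rightarrow> real mat).
         Q \<in> symplectic d \<and>
         Qinv \<in> carrier_mat (2 * d) (2 * d) \<and> inverts_mat Q Qinv \<and> inverts_mat Qinv Q \<and>
         (\<forall>i\<in>{1..5}.
            S (2 * i - 1) \<in> symmetric_mats d \<and>
            S (2 * i) \<in> symmetric_mats (d - 1) \<and>
            M (2 * i - 1) = upper_unit d (S (2 * i - 1)) \<and>
            M (2 * i) = lower_unit d (pad_zero d (S (2 * i))))}
    \<and> (\<forall>Q \<in> symplectic d. \<exists>U :: nat \<Rightarrow> real mat.
         (\<forall>i\<in>{1..9}. U i \<in> unit_triangular_symplectic d) \<and>
         Q = U 9 * U 8 * U 7 * U 6 * U 5 * U 4 * U 3 * U 2 * U 1)"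
proof (intro conjI ballI)
  obtain n where n: "d = Suc n" using assms by (cases d) auto
  then have d: "0 < d" by simp
  have range: "{1..5} = {1, 2, 3, 4, 5 :: nat}" by auto
  show "SPS d = {Q * (M 10 * M 9 * M 8 * M 7 * M 6 * M 5 * M 4 * M 3 * M 2 * M 1) * Qinv
       | (Q :: real mat) (Qinv :: real mat) (M :: nat \<Rightarrow> real mat) (S :: nat \<Rightarrow> real mat).
         Q \<in> symplectic d \<and>
         Qinv \<in> carrier_mat (2 * d) (2 * d) \<and> inverts_mat Q Qinv \<and> inverts_mat Qinv Q \<and>
         (\<forall>i\<in>{1..5}.
            S (2 * i - 1) \<in> symmetric_mats d \<and>
            S (2 * i) \<in> symmetric_mats (d - 1) \<and>
            M (2 * i - 1) = upper_unit d (S (2 * i - 1)) \<and>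
            M (2 * i) = lower_unit d (pad_zero d (S (2 * i))))}" (is "_ = ?R")
  proof (intro equalityI subsetI)
    fix H assume "H \<in> SPS d"
    obtain Q Qinv G where Q: "Q \<in> symplectic d" "Qinv \<in> carrier_mat (2 * d) (2 * d)"
      "Q * Qinv = 1\<^sub>m (2 * d)" "Qinv * Q = 1\<^sub>m (2 * d)"
      and G: "G \<in> symplectic d" "G *\<^sub>v unit_vec (2 * d) 0 = unit_vec (2 * d) 0" and H: "H = Q * G * Qinv"
      using SPS_conjugate_fixing[OF d \<open>H \<in> SPS d\<close>] .
    obtain S1 S2 S3 S4 S5 S6 S7 S8 S9 S10 where
      S: "{S1, S3, S5, S7, S9} \<subseteq> symmetric_mats d" "{S2, S4, S6, S8, S10} \<subseteq> symmetric_mats n"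
      and G_eq: "G = lower_unit d (pad_zero d S10) * upper_unit d S9 * lower_unit d (pad_zero d S8) *
        upper_unit d S7 * lower_unit d (pad_zero d S6) * upper_unit d S5 *
        lower_unit d (pad_zero d S4) * upper_unit d S3 * lower_unit d (pad_zero d S2) * upper_unit d S1"
      using stabilizer_ten_factors[where n = n and G = G, folded n, OF G] .
    \<comment> \<open>Position 0 holds a dummy, so that list positions agree with the indices 1 to
      10; parity then decides the type of the factor.\<close>
    define S where "S = (!) [0\<^sub>m 0 0, S1, S2, S3, S4, S5, S6, S7, S8, S9, S10]"
    define M where "M i = (if odd i then upper_unit d (S i) else lower_unit d (pad_zero d (S i)))" for i
    have "\<forall>i\<in>{1..5}. S (2 * i - 1) \<in> symmetric_mats d \<and> S (2 * i) \<in> symmetric_mats (d - 1) \<and>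
        M (2 * i - 1) = upper_unit d (S (2 * i - 1)) \<and> M (2 * i) = lower_unit d (pad_zero d (S (2 * i)))"
      unfolding range M_def using S by (simp add: S_def n)
    moreover have "H = Q * (M 10 * M 9 * M 8 * M 7 * M 6 * M 5 * M 4 * M 3 * M 2 * M 1) * Qinv"
      unfolding H G_eq M_def by (simp add: S_def)
    moreover have "inverts_mat Q Qinv" "inverts_mat Qinv Q"
      using Q symplectic_carrier[OF Q(1)] by (auto simp: inverts_mat_def)
    ultimately show "H \<in> ?R"
      using Q(1,2) by (intro CollectI exI[of _ Q] exI[of _ Qinv] exI[of _ M] exI[of _ S] conjI)
  next
    fix H assume "H \<in> ?R"
    then obtain Q Qinv and M S :: "nat \<Rightarrow> real mat" where
      H: "H = Q * (M 10 * M 9 * M 8 * M 7 * M 6 * M 5 * M 4 * M 3 * M 2 * M 1) * Qinv"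
      and Q: "Q \<in> symplectic d" "Qinv \<in> carrier_mat (2 * d) (2 * d)" "inverts_mat Q Qinv" "inverts_mat Qinv Q"
      and M: "\<forall>i\<in>{1..5}. S (2 * i - 1) \<in> symmetric_mats d \<and> S (2 * i) \<in> symmetric_mats (d - 1) \<and>
        M (2 * i - 1) = upper_unit d (S (2 * i - 1)) \<and> M (2 * i) = lower_unit d (pad_zero d (S (2 * i)))"
      unfolding mem_Collect_eq by (elim exE conjE) (rule that)
    \<comment> \<open>The stabilizer of the first unit vector: it contains every factor and is
      closed under products, hence contains the whole product.\<close>
    let ?F = "{K \<in> symplectic d. K *\<^sub>v unit_vec (2 * d) 0 = unit_vec (2 * d) 0}"
    have upper: "upper_unit d T \<in> ?F" if "T \<in> symmetric_mats d" for T
      using that upper_unit_symplectic upper_unit_fixes_unit_vec symmetric_mats_carrier unfolding n by auto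
    have lower: "lower_unit d (pad_zero d T) \<in> ?F" if "T \<in> symmetric_mats (d - 1)" for T
      using that lower_unit_symplectic[OF pad_symmetric] lower_unit_pad_fixes_unit_vec symmetric_mats_carrier
      unfolding n by auto
    have mult: "K * L \<in> ?F" if "K \<in> ?F" "L \<in> ?F" for K L
    proof -
      have "(K * L) *\<^sub>v unit_vec (2 * d) 0 = K *\<^sub>v (L *\<^sub>v unit_vec (2 * d) 0)"
        using that by (intro assoc_mult_mat_vec[of _ "2 * d" "2 * d" _ "2 * d"]) (auto intro: symplectic_carrier)
      then show ?thesis using that symplectic_mult by auto
    qed
    have "M (2 * i - 1) \<in> ?F" "M (2 * i) \<in> ?F" if "i \<in> {1..5}" for i
      using M that upper lower by metis+
    \<comment> \<open>For \<open>i\<close> from 1 to 5, the numbers 2i - 1 and 2i run through all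
      indices from 1 to 10.\<close>
    from this[of 1] this[of 2] this[of 3] this[of 4] this[of 5]
    have "M 1 \<in> ?F" "M 2 \<in> ?F" "M 3 \<in> ?F" "M 4 \<in> ?F" "M 5 \<in> ?F" "M 6 \<in> ?F" "M 7 \<in> ?F" "M 8 \<in> ?F"
      "M 9 \<in> ?F" "M 10 \<in> ?F" by simp_all
    then have "M 10 * M 9 * M 8 * M 7 * M 6 * M 5 * M 4 * M 3 * M 2 * M 1 \<in> ?F"
      by (intro mult)
    moreover have "Q * Qinv = 1\<^sub>m (2 * d)" "Qinv * Q = 1\<^sub>m (2 * d)"
      using Q symplectic_carrier[OF Q(1)] by (auto simp: inverts_mat_def)
    ultimately show "H \<in> SPS d"
      unfolding H using conjugate_fixing_in_SPS[OF d Q(1,2)] by blast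
  qed
qed (rule symplectic_nine_factors)

end
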